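(* Let $D\ge 1$ and, for each $d\in\{1,\dots,D\}$, let $J_d\ge 1$ and let $\phi_{d,1},\dots,\phi_{d,J_d}:\mathbb{R}\to\mathbb{R}$ be the Gaussian RBF basis functions $\phi_{d,j}(u)=\exp\!\big(-(u-c_{d,j})^2/(2l_d^2)\big)$ with centers $c_{d,j}\in\mathbb{R}$ and length scale $l_d>0$. Let $\sigma_w^2>0$ and let $w_{d,j}^{(m)}$, for $d\in\{1,\dots,D\}$, $j\in\{1,\dots,J_d\}$, $m\in\{1,2,\dots\}$, be i.i.d. $\mathcal{N}(0,\sigma_w^2)$ random variables (independent across all indices $(d,j,m)$). For each $M\ge 1$ and $x\in\mathbb{R}^D$ define $$\bar y^{(M)}(x)=\frac{1}{\sqrt M}\sum_{m=1}^M\prod_{d=1}^D\Big(\sum_{j=1}^{J_d}\phi_{d,j}(x_d)\,w_{d,j}^{(m)}\Big).$$ Let $X=\{x^{(i)}\}_{i=1}^n\subset\mathbb{R}^D$ be training inputs, let $X_*=\{x_*^{(j)}\}_{j=1}^{n_*}\subset\mathbb{R}^D$ be test inputs, and fix observed data $\mathcal{D}=(X,\tilde y)$ with $\tilde y\in\mathbb{R}^n$. For each $M$, define the posterior of $\bar y^{(M)}$ given $\mathcal{D}$ using the Gaussian likelihood $$\tilde y\mid \bar y^{(M)}\sim\mathcal{N}\big(\bar y^{(M)}(X),\,\sigma_n^2 I_n\big),\qquad \sigma_n^2>0\text{ fixed}.$$ Let $g\sim\mathrm{GP}(0,k)$ be the centered Gaussian process on $\mathbb{R}^D$ with kernel $$k(x,x')=\prod_{d=1}^D\Big(\sigma_w^2\sum_{j=1}^{J_d}\phi_{d,j}(x_d)\,\phi_{d,j}(x_d')\Big),$$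 and let $g(X_* )\mid\mathcal{D}$ be its posterior at $X_*$ under the likelihood $\tilde y\mid g\sim\mathcal{N}(g(X),\sigma_n^2 I_n)$. Then, as $M\to\infty$, $$\bar y^{(M)}(X_* )\mid\mathcal{D}\;\Rightarrow\; g(X_* )\mid\mathcal{D}\quad\text{in distribution on }\mathbb{R}^{n_*}.$$ Moreover, the limiting conditional distribution $g(X_* )\mid\mathcal{D}$ is exactly the standard Gaussian-process regression posterior distribution at $X_*$ associated with the prior $g\sim\mathrm{GP}(0,k)$ and noise variance $\sigma_n^2$, that is, the multivariate normal distribution on $\mathbb{R}^{n_*}$ with mean $K(X_*,X)\,[K(X,X)+\sigma_n^2 I_n]^{-1}\tilde y$ and covariance $K(X_*,X_* )-K(X_*,X)\,[K(X,X)+\sigma_n^2 I_n]^{-1}K(X,X_* )$.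
   Context: For a function (or random function) $h$ on $\mathbb{R}^D$, $h(X)=(h(x^{(1)}),\dots,h(x^{(n)}))\in\mathbb{R}^n$ and $h(X_* )=(h(x_*^{(1)}),\dots,h(x_*^{(n_* )}))\in\mathbb{R}^{n_*}$. For finite lists of points $A=(a_i)$, $B=(b_j)$ in $\mathbb{R}^D$, $K(A,B)$ is the matrix with entries $k(a_i,b_j)$. A centered Gaussian process $g\sim\mathrm{GP}(0,k)$ is a random function all of whose finite-dimensional evaluation vectors are multivariate normal (possibly degenerate) with mean $0$ and covariances given by $k$. Posterior: for a random function $h$ (either $\bar y^{(M)}$ or $g$), the posterior $h(X_* )\mid\mathcal{D}$ is the probability measure on $\mathbb{R}^{n_*}$ given by Bayes' rule, $$\mathbb{P}\big(h(X_* )\in B\mid\mathcal{D}\big)=\frac{\mathbb{E}\big[\mathbf{1}\{h(X_* )\in B\}\,\ell(h(X))\big]}{\mathbb{E}\big[\ell(h(X))\big]},\qquad \ell(z)=\exp\!\Big(-\tfrac{1}{2\sigma_n^2}\|\tilde y-z\|_2^2\Big),\ z\in\mathbb{R}^n,$$ for Borel sets $B\subset\mathbb{R}^{n_*}$, where the expectation is over the prior law of $h$. The symbol $\Rightarrow$ denotes weak convergence of probability measures. The quantities $D$, $J_d$, $c_{d,j}$, $l_d$, $\sigma_w^2$, $\sigma_n^2$, $X$, $X_*$, $\tilde y$ are fixed and do not depend on $M$. *)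

theory Defs
  imports "HOL-Probability.Probability"
begin

section \<open>Gaussian vectors and Gaussian processes\<close>

text \<open>The univariate normal law with mean \<open>\<mu>\<close> and variance \<open>v \<ge> 0\<close>; the degenerate case \<open>v = 0\<close>
  is the Dirac measure (the library's \<^const>\<open>normal_density\<close> has no degenerate case and takes the
  standard deviation).\<close>

definition normal_law :: "real \<Rightarrow> real \<Rightarrow> real measure" where
  "normal_law \<mu> v =
    (if v = 0 then return borel \<mu> else density lborel (\<lambda>x. ennreal (normal_density \<mu> (sqrt v) x)))"

text \<open>\<open>(X i)\<close>, \<open>i \<in> I\<close>, is a possibly degenerate multivariate normal vector: every linear combination of
  its entries is univariate normal. The index set is a parameter, so that the same notion serves for
  vectors of every finite dimension and for vectors of type \<open>real^'s\<close>.\<close>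

definition multivariate_normal ::
  "'a measure \<Rightarrow> 'i set \<Rightarrow> ('i \<Rightarrow> 'a \<Rightarrow> real) \<Rightarrow> ('i \<Rightarrow> real) \<Rightarrow> ('i \<Rightarrow> 'i \<Rightarrow> real) \<Rightarrow> bool" where
  "multivariate_normal M I X m S \<longleftrightarrow>
     prob_space M \<and> finite I \<and> (\<forall>i\<in>I. X i \<in> borel_measurable M) \<and>
     (\<forall>a :: 'i \<Rightarrow> real. \<exists>\<mu> v. v \<ge> 0 \<and> distr M borel (\<lambda>\<omega>. \<Sum>i\<in>I. a i * X i \<omega>) = normal_law \<mu> v) \<and>
     (\<forall>i\<in>I. (\<integral>\<omega>. X i \<omega> \<partial>M) = m i) \<and>
     (\<forall>i\<in>I. \<forall>j\<in>I. (\<integral>\<omega>. (X i \<omega> - m i) * (X j \<omega> - m j) \<partial>M) = S i j)"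

definition multivariate_normal_law :: "(real^'s) measure \<Rightarrow> real^'s \<Rightarrow> real^'s^'s \<Rightarrow> bool" where
  "multivariate_normal_law \<nu> m S \<longleftrightarrow>
     sets \<nu> = sets borel \<and>
     multivariate_normal \<nu> UNIV (\<lambda>i z. z $ i) (\<lambda>i. m $ i) (\<lambda>i j. S $ i $ j)"

definition centered_gaussian_process :: "'a measure \<Rightarrow> ('x \<Rightarrow> 'a \<Rightarrow> real) \<Rightarrow> ('x \<Rightarrow> 'x \<Rightarrow> real) \<Rightarrow> bool" where
  "centered_gaussian_process M g k \<longleftrightarrow>
     (\<forall>(p :: nat) (x :: nat \<Rightarrow> 'x).
        multivariate_normal M {..<p} (\<lambda>i. g (x i)) (\<lambda>_. 0) (\<lambda>i j. k (x i) (x j)))"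


section \<open>Bayesian posterior\<close>

text \<open>A list of \<open>n\<close> points of \<open>\<real>\<^sup>D\<close> is a vector of points, of type \<open>(real^'d)^'n\<close>.\<close>

definition eval_at :: "('x \<Rightarrow> 'a \<Rightarrow> real) \<Rightarrow> 'x^'n \<Rightarrow> 'a \<Rightarrow> real^'n" where
  "eval_at h X \<omega> = (\<chi> i. h (X $ i) \<omega>)"

definition likelihood :: "real \<Rightarrow> real^'n \<Rightarrow> real^'n \<Rightarrow> real" where
  "likelihood \<sigma>n y z = exp (- (1 / (2 * \<sigma>n\<^sup>2) * (norm (y - z))\<^sup>2))"

definition posterior ::
  "'a measure \<Rightarrow> ('x \<Rightarrow> 'a \<Rightarrow> real) \<Rightarrow> 'x^'n \<Rightarrow> real^'n \<Rightarrow> real \<Rightarrow> 'x^'s \<Rightarrow> (real^'s) measure" where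
  "posterior M h X y \<sigma>n Xs =
     measure_of UNIV (sets borel)
       (\<lambda>B. ennreal ((\<integral>\<omega>. indicator B (eval_at h Xs \<omega>) * likelihood \<sigma>n y (eval_at h X \<omega>) \<partial>M)
                    / (\<integral>\<omega>. likelihood \<sigma>n y (eval_at h X \<omega>) \<partial>M)))"

text \<open>For a random function on a probability space, Bayes' formula does define a probability measure,
  so \<^const>\<open>measure_of\<close> does not collapse to the zero measure.\<close>

lemma measurable_eval_at [measurable]:
  fixes X :: "'x^'n"
  assumes "\<And>x. h x \<in> borel_measurable M"
  shows "eval_at h X \<in> borel_measurable M"
proof (rule borel_measurable_euclidean_space[THEN iffD2], rule ballI)
  fix b :: "real^'n" assume "b \<in> Basis"
  then obtain i where b: "b = axis i 1" by (auto simp: Basis_vec_def)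
  show "(\<lambda>\<omega>. eval_at h X \<omega> \<bullet> b) \<in> borel_measurable M"
    using assms by (simp add: b eval_at_def inner_axis)
qed

lemma measurable_likelihood [measurable]: "likelihood \<sigma>n y \<in> borel_measurable borel"
  unfolding likelihood_def by measurable

lemma
  fixes M :: "'a measure" and h :: "'x \<Rightarrow> 'a \<Rightarrow> real"
  assumes "prob_space M" and h: "\<And>x. h x \<in> borel_measurable M"
  shows sets_posterior: "sets (posterior M h X y \<sigma>n Xs) = sets borel"
    and prob_space_posterior: "prob_space (posterior M h X y \<sigma>n Xs)"
    and measure_posterior: "B \<in> sets borel \<Longrightarrow>
      measure (posterior M h X y \<sigma>n Xs) B =
        (\<integral>\<omega>. indicator B (eval_at h Xs \<omega>) * likelihood \<sigma>n y (eval_at h X \<omega>) \<partial>M)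
          / (\<integral>\<omega>. likelihood \<sigma>n y (eval_at h X \<omega>) \<partial>M)"
proof -
  interpret prob_space M by fact
  define L where "L = (\<lambda>\<omega>. likelihood \<sigma>n y (eval_at h X \<omega>))"
  define Z where "Z = (\<integral>\<omega>. L \<omega> \<partial>M)"
  define F where "F = (\<lambda>B. (\<integral>\<omega>. indicator B (eval_at h Xs \<omega>) * L \<omega> \<partial>M) / Z)"
  define P where "P = distr (density M (\<lambda>\<omega>. ennreal (L \<omega> / Z))) borel (eval_at h Xs)"
  note [measurable] = measurable_eval_at[of h M, OF h]
  have L_meas [measurable]: "L \<in> borel_measurable M" unfolding L_def by measurable
  have L_pos: "L \<omega> > 0" and L_le: "L \<omega> \<le> 1" for \<omega>
    by (simp_all add: L_def likelihood_def)
  have L_int: "integrable M L"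
    by (rule integrable_const_bound[of _ 1]) (use L_pos L_le in \<open>auto simp: abs_of_pos\<close>)
  have "Z \<ge> 0" unfolding Z_def using L_pos by (intro integral_nonneg_AE) (auto intro: less_imp_le)
  moreover have "Z \<noteq> 0"
  proof
    assume "Z = 0"
    then have "AE \<omega> in M. L \<omega> = 0"
      using integral_nonneg_eq_0_iff_AE[OF L_int] L_pos unfolding Z_def by (auto intro: less_imp_le)
    moreover have "L \<omega> \<noteq> 0" for \<omega> using L_pos[of \<omega>] by simp
    ultimately show False by simp
  qed
  ultimately have Z_pos: "Z > 0" by simp
  have F_nonneg: "F B \<ge> 0" for B
    unfolding F_def using Z_pos L_pos
    by (intro divide_nonneg_pos integral_nonneg_AE AE_I2 mult_nonneg_nonneg) (auto intro: less_imp_le)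
  have emP: "emeasure P B = ennreal (F B)" if [measurable]: "B \<in> sets borel" for B
  proof -
    have int: "integrable M (\<lambda>\<omega>. indicator B (eval_at h Xs \<omega>) * L \<omega>)"
      by (rule integrable_const_bound[of _ 1])
         (use L_pos L_le in \<open>auto simp: abs_of_pos split: split_indicator\<close>)
    have "emeasure P B = emeasure (density M (\<lambda>\<omega>. ennreal (L \<omega> / Z))) (eval_at h Xs -` B \<inter> space M)"
      unfolding P_def by (subst emeasure_distr) auto
    also have "\<dots> = (\<integral>\<^sup>+\<omega>. ennreal (L \<omega> / Z) * indicator (eval_at h Xs -` B \<inter> space M) \<omega> \<partial>M)"
      by (rule emeasure_density) measurable
    also have "\<dots> = (\<integral>\<^sup>+\<omega>. ennreal (indicator B (eval_at h Xs \<omega>) * L \<omega> / Z) \<partial>M)"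
      by (intro nn_integral_cong) (auto split: split_indicator)
    also have "\<dots> = ennreal (\<integral>\<omega>. indicator B (eval_at h Xs \<omega>) * L \<omega> / Z \<partial>M)"
      using int L_pos Z_pos
      by (intro nn_integral_eq_integral AE_I2 divide_nonneg_pos mult_nonneg_nonneg) (auto intro: less_imp_le)
    finally show ?thesis by (simp add: F_def)
  qed
  have "P = measure_of UNIV (sets borel) (emeasure P)"
    using measure_of_of_measure[of P] by (simp add: P_def)
  also have "\<dots> = measure_of UNIV (sets borel) (\<lambda>B. ennreal (F B))"
    by (rule measure_of_eq) (auto simp: emP sets.sigma_sets_eq[of borel, simplified])
  finally have post: "posterior M h X y \<sigma>n Xs = P"
    unfolding posterior_def F_def Z_def L_def by simp
  show "sets (posterior M h X y \<sigma>n Xs) = sets borel" by (simp add: post P_def)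
  show "prob_space (posterior M h X y \<sigma>n Xs)"
  proof
    have "F UNIV = 1" using Z_pos by (simp add: F_def Z_def[symmetric])
    then have "emeasure P UNIV = 1" using emP[of UNIV] by simp
    then show "emeasure (posterior M h X y \<sigma>n Xs) (space (posterior M h X y \<sigma>n Xs)) = 1"
      by (simp add: post P_def)
  qed
  show "B \<in> sets borel \<Longrightarrow>
      measure (posterior M h X y \<sigma>n Xs) B =
        (\<integral>\<omega>. indicator B (eval_at h Xs \<omega>) * likelihood \<sigma>n y (eval_at h X \<omega>) \<partial>M)
          / (\<integral>\<omega>. likelihood \<sigma>n y (eval_at h X \<omega>) \<partial>M)"
    using emP[of B] F_nonneg[of B] by (simp add: post measure_def F_def Z_def L_def)
qed


section \<open>Weak convergence of probability measures\<close>

text \<open>The library's \<^const>\<open>weak_conv_m\<close> is defined through distribution functions and only covers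
  measures on \<open>\<real>\<close>.\<close>

definition weakly_converges :: "(nat \<Rightarrow> 'a::topological_space measure) \<Rightarrow> 'a measure \<Rightarrow> bool" where
  "weakly_converges \<mu> \<nu> \<longleftrightarrow>
     (\<forall>M. prob_space (\<mu> M) \<and> sets (\<mu> M) = sets borel) \<and> prob_space \<nu> \<and> sets \<nu> = sets borel \<and>
     (\<forall>f :: 'a \<Rightarrow> real. continuous_on UNIV f \<longrightarrow> bounded (range f) \<longrightarrow>
        (\<lambda>M. \<integral>z. f z \<partial>\<mu> M) \<longlonglongrightarrow> (\<integral>z. f z \<partial>\<nu>))"


section \<open>The random-weight model and its limiting kernel\<close>

definition rbf :: "real \<Rightarrow> real \<Rightarrow> real \<Rightarrow> real" where
  "rbf c l u = exp (- ((u - c)\<^sup>2 / (2 * l\<^sup>2)))"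

text \<open>\<open>\<phi> d j\<close> is the \<open>j\<close>-th basis function in coordinate \<open>d\<close> and \<open>w d j m\<close> the weight
  \<open>w\<^sub>d\<^sub>,\<^sub>j\<^sup>(\<^sup>m\<^sup>)\<close>; the indices \<open>j\<close> and \<open>m\<close> start at 1. The value at \<open>M = 0\<close> is the zero function and
  plays no role in the limit.\<close>

definition ybar ::
  "('d \<Rightarrow> nat) \<Rightarrow> ('d \<Rightarrow> nat \<Rightarrow> real \<Rightarrow> real) \<Rightarrow> ('d \<Rightarrow> nat \<Rightarrow> nat \<Rightarrow> 'a \<Rightarrow> real) \<Rightarrow>
   nat \<Rightarrow> real^'d \<Rightarrow> 'a \<Rightarrow> real" where
  "ybar J \<phi> w M x \<omega> =
     1 / sqrt (real M) * (\<Sum>m=1..M. \<Prod>d\<in>UNIV. \<Sum>j=1..J d. \<phi> d j (x $ d) * w d j m \<omega>)"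

definition kernel ::
  "('d \<Rightarrow> nat) \<Rightarrow> ('d \<Rightarrow> nat \<Rightarrow> real \<Rightarrow> real) \<Rightarrow> real \<Rightarrow> real^'d \<Rightarrow> real^'d \<Rightarrow> real" where
  "kernel J \<phi> \<sigma>w x x' = (\<Prod>d\<in>UNIV. \<sigma>w\<^sup>2 * (\<Sum>j=1..J d. \<phi> d j (x $ d) * \<phi> d j (x' $ d)))"

definition kernel_matrix :: "('x \<Rightarrow> 'x \<Rightarrow> real) \<Rightarrow> 'x^'p \<Rightarrow> 'x^'q \<Rightarrow> real^'q^'p" where
  "kernel_matrix k A B = (\<chi> i j. k (A $ i) (B $ j))"

end

theory Submission
  imports Defs
begin

text \<open>Bayes' rule writes the posterior as a quotient of expectations of bounded continuous functions of
  the joint vector of test and training values, so it suffices that this vector converges weakly under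
  the prior. Its characteristic function converges by the one-dimensional central limit theorem applied
  to linear combinations of the i.i.d. product features, whose covariance factorizes over the
  coordinates into the kernel; since second moments are bounded, Stone-Weierstrass turns this into weak
  convergence.

  For the limit, the likelihood is a product of one-dimensional Gaussian factors. Tilting a Gaussian
  vector by one such factor keeps it Gaussian and changes mean and covariance by a rank-one update;
  after all observations the updates solve the normal equations of Gaussian process regression.\<close>


section \<open>Weak convergence from characteristic functions and second moments\<close>

text \<open>Expanding the product over coordinates shows the kernel as an inner product of finitely
  many features, one for each choice of one basis function per coordinate. Kernel matrices of many
  points are therefore singular, and the joint vector of test and training values need not have a
  density. So conditioning never divides densities: Gaussian facts are stated through characteristic
  functions, and a Gaussian likelihood factor is rewritten as a mixture of characters over an
  auxiliary standard normal variable, which turns conditioning into one explicit integral. The same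
  language serves the limit. The passage from characters to bounded continuous functions is done by
  hand: each coordinate \<open>u\<close> is replaced by \<open>L * sin (u / L)\<close>, which is
  bounded, close to \<open>u\<close> on bounded sets, and keeps polynomials trigonometric. What
  happens far out is paid for by the second moments, which the trace of the kernel matrix bounds
  uniformly in \<open>M\<close>.\<close>

inductive trig_poly :: "('a::euclidean_space \<Rightarrow> complex) \<Rightarrow> bool" where
  cis: "trig_poly (\<lambda>x. c * cis (t \<bullet> x))"
| add: "trig_poly f \<Longrightarrow> trig_poly g \<Longrightarrow> trig_poly (\<lambda>x. f x + g x)"

lemma trig_poly_const: "trig_poly (\<lambda>_. c)"
  using trig_poly.cis[of c 0] by simp

text \<open>Frequencies add when characters are multiplied; the nested induction is the bilinear
  expansion of the product. Together with \<open>add\<close> this gives the algebra structure that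
  polynomials in sines call for.\<close>

lemma trig_poly_mult:
  assumes "trig_poly f" "trig_poly g"
  shows "trig_poly (\<lambda>x. f x * g x)"
  using assms(1)
proof induction
  case (cis c t)
  show ?case using assms(2)
  proof induction
    case (cis d s)
    have "(\<lambda>x. c * cis (t \<bullet> x) * (d * cis (s \<bullet> x))) = (\<lambda>x. (c * d) * cis ((t + s) \<bullet> x))"
      by (simp add: cis_mult[symmetric] inner_add_left algebra_simps fun_eq_iff)
    then show ?case using trig_poly.cis[of "c * d" "t + s"] by simp
  next
    case (add f g)
    then show ?case using trig_poly.add by (fastforce simp: algebra_simps)
  qed
next
  case (add f g)
  then show ?case using trig_poly.add by (fastforce simp: algebra_simps)
qed

lemma trig_poly_sum:
  "finite A \<Longrightarrow> (\<And>i. i \<in> A \<Longrightarrow> trig_poly (f i)) \<Longrightarrow> trig_poly (\<lambda>x. \<Sum>i\<in>A. f i x)"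
  by (induction A rule: finite_induct) (auto intro: trig_poly_const trig_poly.add)

lemma trig_poly_sin: "trig_poly (\<lambda>x. complex_of_real (sin (t \<bullet> x)))"
proof -
  have "complex_of_real (sin u) = (- \<i> / 2) * cis u + (\<i> / 2) * cis (- u)" for u
    by (simp add: complex_eq_iff)
  then show ?thesis
    using trig_poly.add[OF trig_poly.cis[of "- \<i> / 2" t] trig_poly.cis[of "\<i> / 2" "- t"]] by simp
qed

text \<open>A bounded substitute for the identity map, approaching it on bounded sets as
  \<open>L\<close> grows. Sines are preferred to a cutoff because a polynomial in them is still a
  trigonometric polynomial.\<close>

definition sin_scale :: "real \<Rightarrow> 'a::euclidean_space \<Rightarrow> 'a" where
  "sin_scale L x = (\<Sum>b\<in>Basis. (L * sin (x \<bullet> b / L)) *\<^sub>R b)"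

lemma inner_sin_scale: "b \<in> Basis \<Longrightarrow> sin_scale L x \<bullet> b = L * sin (x \<bullet> b / L)"
  by (simp add: sin_scale_def inner_sum_left_Basis)

text \<open>Only the linear case has content: a linear functional is a combination of coordinates,
  and each coordinate of \<open>sin_scale L x\<close> is a sine with frequency vector
  \<open>b /\<^sub>R L\<close>.\<close>

lemma trig_poly_polynomial_sin_scale:
  assumes "real_polynomial_function p"
  shows "trig_poly (\<lambda>x. complex_of_real (p (sin_scale L x)))"
  using assms
proof induction
  case (linear f)
  have eq: "(\<lambda>x. complex_of_real (f (sin_scale L x))) =
      (\<lambda>x. \<Sum>b\<in>Basis. complex_of_real (L * f b) * complex_of_real (sin ((b /\<^sub>R L) \<bullet> x)))"
    using linear
    by (auto simp: sin_scale_def linear_sum linear_scale bounded_linear.linear inner_commute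
        divide_inverse mult_ac intro!: ext sum.cong)
  show ?case unfolding eq
    by (intro trig_poly_sum trig_poly_mult trig_poly_const trig_poly_sin) auto
next
  case (const c)
  show ?case by (rule trig_poly_const)
next
  case (add f g)
  then show ?case using trig_poly.add by fastforce
next
  case (mult f g)
  then show ?case using trig_poly_mult by fastforce
qed

text \<open>Follows from \<open>|sin u| <= |u|\<close> in each coordinate. Balls around 0 are thus
  mapped into themselves, so uniform continuity on a ball can compare \<open>x\<close> with its
  image.\<close>

lemma norm_sin_scale_le: "norm (sin_scale L x) \<le> norm x"
proof (rule norm_le_componentwise)
  fix b :: 'a assume b: "b \<in> Basis"
  show "\<bar>sin_scale L x \<bullet> b\<bar> \<le> \<bar>x \<bullet> b\<bar>"
  proof (cases "L = 0")
    case False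
    have "\<bar>L\<bar> * \<bar>sin (x \<bullet> b / L)\<bar> \<le> \<bar>L\<bar> * \<bar>x \<bullet> b / L\<bar>"
      by (intro mult_left_mono abs_sin_x_le_abs_x) auto
    then show ?thesis using False b by (simp add: inner_sin_scale abs_mult)
  qed (simp add: inner_sin_scale b)
qed

text \<open>Provides the compact set for Stone-Weierstrass, fixed once \<open>L\<close> is fixed;
  the crude bound by the sum of the coordinates is enough for that.\<close>

lemma sin_scale_bounded: "sin_scale L x \<in> cball 0 (real DIM('a) * \<bar>L\<bar>)" for x :: "'a::euclidean_space"
proof -
  have "norm (sin_scale L x) \<le> (\<Sum>b\<in>Basis. \<bar>sin_scale L x \<bullet> b\<bar>)" by (rule norm_le_l1)
  also have "\<dots> \<le> (\<Sum>b\<in>(Basis::'a set). \<bar>L\<bar> * 1)"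
    by (intro sum_mono) (simp add: inner_sin_scale abs_mult mult_left_le)
  finally show ?thesis by simp
qed

lemma norm_sin_scale_diff:
  fixes x :: "'a::euclidean_space"
  assumes "L > 0" "norm x \<le> R"
  shows "norm (sin_scale L x - x) \<le> real DIM('a) * R\<^sup>2 / (2 * L)"
proof -
  have "norm (sin_scale L x - x) \<le> (\<Sum>b\<in>Basis. \<bar>(sin_scale L x - x) \<bullet> b\<bar>)" by (rule norm_le_l1)
  also have "\<dots> \<le> (\<Sum>b\<in>(Basis::'a set). R\<^sup>2 / (2 * L))"
  proof (rule sum_mono)
    fix b :: 'a assume b: "b \<in> Basis"
    define u where "u = x \<bullet> b / L"
    \<comment> \<open>The first two Taylor terms of \<open>sin\<close> at 0 add up to
      \<open>u\<close>, so the quadratic remainder bound applies; after multiplication by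
      \<open>L\<close> it is of order \<open>1 / L\<close>.\<close>
    have "\<bar>sin u - u\<bar> \<le> u\<^sup>2 / 2"
      using Maclaurin_sin_bound[of u 2] by (simp add: numeral_2_eq_2 sin_coeff_def)
    then have "L * \<bar>sin u - u\<bar> \<le> L * (u\<^sup>2 / 2)" using assms(1) by simp
    also have "\<dots> = (x \<bullet> b)\<^sup>2 / (2 * L)" using assms(1) by (simp add: u_def power2_eq_square)
    also have "\<dots> \<le> R\<^sup>2 / (2 * L)"
    proof -
      have "\<bar>x \<bullet> b\<bar> \<le> R" using Basis_le_norm[OF b, of x] assms(2) by linarith
      then have "(x \<bullet> b)\<^sup>2 \<le> R\<^sup>2" by (rule abs_le_square_iff[THEN iffD1, OF order_trans[OF _ abs_ge_self]])
      then show ?thesis using assms(1) by (simp add: divide_right_mono)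
    qed
    finally have "L * \<bar>sin u - u\<bar> \<le> R\<^sup>2 / (2 * L)" .
    moreover have "(sin_scale L x - x) \<bullet> b = L * (sin u - u)"
      using b assms(1) by (simp add: inner_diff_left inner_sin_scale u_def algebra_simps)
    ultimately show "\<bar>(sin_scale L x - x) \<bullet> b\<bar> \<le> R\<^sup>2 / (2 * L)" using assms(1) by (simp add: abs_mult)
  qed
  finally show ?thesis by simp
qed

section \<open>From characters to bounded continuous test functions\<close>

lemma continuous_on_trig_poly: "trig_poly f \<Longrightarrow> continuous_on UNIV f"
  by (induction rule: trig_poly.induct) (auto simp: cis_conv_exp intro!: continuous_intros)

lemma trig_poly_bounded: "trig_poly f \<Longrightarrow> \<exists>B. \<forall>x. norm (f x) \<le> B"
proof (induction rule: trig_poly.induct)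
  case (cis c t)
  show ?case by (rule exI[of _ "norm c"]) (simp add: norm_mult)
next
  case (add f g)
  then obtain A B where "\<forall>x. norm (f x) \<le> A" "\<forall>x. norm (g x) \<le> B" by blast
  then show ?case by (intro exI[of _ "A + B"]) (meson add_mono norm_triangle_ineq order_trans)
qed

lemma integrable_bounded_continuous:
  fixes f :: "'a::euclidean_space \<Rightarrow> 'b::{banach,second_countable_topology}"
  assumes "prob_space \<mu>" "sets \<mu> = sets borel" "continuous_on UNIV f" "\<And>x. norm (f x) \<le> B"
  shows "integrable \<mu> f"
proof -
  interpret prob_space \<mu> by fact
  have "f \<in> borel_measurable \<mu>"
    using borel_measurable_continuous_onI[OF assms(3)] measurable_cong_sets[OF assms(2) refl] by blast
  then show ?thesis using assms(4) by (intro integrable_const_bound[of _ B]) auto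
qed

lemma tendsto_integral_trig_poly:
  fixes f :: "'a::euclidean_space \<Rightarrow> complex"
  assumes \<mu>: "\<And>n. prob_space (\<mu> n)" "\<And>n. sets (\<mu> n) = sets borel"
    and \<nu>: "prob_space \<nu>" "sets \<nu> = sets borel"
    and char: "\<And>t. (\<lambda>n. \<integral>x. cis (t \<bullet> x) \<partial>\<mu> n) \<longlonglongrightarrow> (\<integral>x. cis (t \<bullet> x) \<partial>\<nu>)"
    and f: "trig_poly f"
  shows "(\<lambda>n. \<integral>x. f x \<partial>\<mu> n) \<longlonglongrightarrow> (\<integral>x. f x \<partial>\<nu>)"
  using f
proof induction
  case (cis c t)
  show ?case using tendsto_mult_left[OF char[of t], of c] by simp
next
  case (add f g)
  have int: "integrable \<kappa> h" if "prob_space \<kappa>" "sets \<kappa> = sets borel" "trig_poly h" for \<kappa> and h :: "'a \<Rightarrow> complex"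
    using integrable_bounded_continuous[OF that(1,2)] trig_poly_bounded[OF that(3)]
      continuous_on_trig_poly[OF that(3)] by blast
  show ?case using tendsto_add[OF add.IH] int[OF \<mu>] int[OF \<nu>] add.hyps by simp
qed

text \<open>Inside the ball uniform continuity yields \<open>e\<close>; outside, the trivial bound
  \<open>2 * B\<close> is enlarged by the factor \<open>(norm x)^2 / R^2\<close>, which is at least
  1 there. The estimate is pointwise, so one \<open>L\<close> serves all measures at once and
  integration leaves only a second moment.\<close>

lemma bounded_continuous_sin_scale_error:
  fixes f :: "'a::euclidean_space \<Rightarrow> real"
  assumes f: "continuous_on UNIV f" and B: "\<And>x. \<bar>f x\<bar> \<le> B" and e: "e > 0" and R: "R > 0"
  obtains L where "L > 0" "\<And>x. \<bar>f x - f (sin_scale L x)\<bar> \<le> e + 2 * B * (norm x)\<^sup>2 / R\<^sup>2"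
proof -
  have "uniformly_continuous_on (cball 0 R) f"
    by (rule compact_uniformly_continuous) (auto intro: continuous_on_subset[OF f])
  then obtain \<delta> where \<delta>: "\<delta> > 0"
    and uc: "\<And>x x'. x \<in> cball 0 R \<Longrightarrow> x' \<in> cball 0 R \<Longrightarrow> dist x' x < \<delta> \<Longrightarrow> dist (f x') (f x) < e"
    unfolding uniformly_continuous_on_def using e by meson
  \<comment> \<open>Chosen so that the bound of \<open>norm_sin_scale_diff\<close> on the ball of
    radius \<open>R\<close> equals \<open>\<delta> / 2\<close>.\<close>
  define L where "L = real DIM('a) * R\<^sup>2 / \<delta>"
  have L: "L > 0" using \<delta> R by (simp add: L_def)
  have half: "real DIM('a) * R\<^sup>2 / (2 * L) = \<delta> / 2" using \<delta> R by (simp add: L_def)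
  have B0: "B \<ge> 0" using B[of 0] by linarith
  have "\<bar>f x - f (sin_scale L x)\<bar> \<le> e + 2 * B * (norm x)\<^sup>2 / R\<^sup>2" for x
  proof (cases "norm x \<le> R")
    case True
    have "dist (sin_scale L x) x < \<delta>"
      using norm_sin_scale_diff[OF L True] \<delta> unfolding half dist_norm by linarith
    then have "dist (f (sin_scale L x)) (f x) < e"
      using True norm_sin_scale_le[of L x] by (intro uc) auto
    moreover have "2 * B * (norm x)\<^sup>2 / R\<^sup>2 \<ge> 0" using B0 by simp
    ultimately show ?thesis by (simp add: dist_real_def abs_minus_commute)
  next
    case False
    have "R\<^sup>2 \<le> (norm x)\<^sup>2" using False R by (intro power_mono) auto
    then have "2 * B * 1 \<le> 2 * B * ((norm x)\<^sup>2 / R\<^sup>2)"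
      using B0 R by (intro mult_left_mono) auto
    moreover have "\<bar>f x - f (sin_scale L x)\<bar> \<le> 2 * B" using B[of x] B[of "sin_scale L x"] by linarith
    ultimately show ?thesis using e by simp
  qed
  then show thesis using that L by blast
qed

text \<open>A bounded continuous \<open>f\<close> is compared with \<open>f \<circ> sin_scale L\<close>: the error is small on a large
  ball and controlled by the second moments outside, and \<open>f \<circ> sin_scale L\<close> is a uniform limit of
  trigonometric polynomials by Stone-Weierstrass, since \<open>sin_scale L\<close> has bounded range.\<close>

theorem weakly_converges_characteristic:
  fixes \<mu> :: "nat \<Rightarrow> 'a::euclidean_space measure" and \<nu> :: "'a measure"
  assumes \<mu>: "\<And>n. prob_space (\<mu> n)" "\<And>n. sets (\<mu> n) = sets borel"
    and \<nu>: "prob_space \<nu>" "sets \<nu> = sets borel"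
    and char: "\<And>t. (\<lambda>n. \<integral>x. cis (t \<bullet> x) \<partial>\<mu> n) \<longlonglongrightarrow> (\<integral>x. cis (t \<bullet> x) \<partial>\<nu>)"
    and mom_\<mu>: "\<And>n. integrable (\<mu> n) (\<lambda>x. (norm x)\<^sup>2)" "\<And>n. (\<integral>x. (norm x)\<^sup>2 \<partial>\<mu> n) \<le> C"
    and mom_\<nu>: "integrable \<nu> (\<lambda>x. (norm x)\<^sup>2)" "(\<integral>x. (norm x)\<^sup>2 \<partial>\<nu>) \<le> C"
  shows "weakly_converges \<mu> \<nu>"
  unfolding weakly_converges_def
proof (intro conjI allI impI)
  fix f :: "'a \<Rightarrow> real" assume f: "continuous_on UNIV f" and "bounded (range f)"
  then obtain B where B: "\<And>x. \<bar>f x\<bar> \<le> B" unfolding bounded_iff by auto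
  then have B0: "B \<ge> 0" using B[of 0] by linarith
  have C0: "C \<ge> 0" using mom_\<nu>(2) order_trans[OF Bochner_Integration.integral_nonneg] by (metis (no_types, lifting) zero_le_power2)
  show "(\<lambda>n. \<integral>x. f x \<partial>\<mu> n) \<longlonglongrightarrow> (\<integral>x. f x \<partial>\<nu>)"
  proof (rule LIMSEQ_I)
    fix r :: real assume r: "r > 0"
    \<comment> \<open>Replacing \<open>f\<close> by \<open>h\<close> costs \<open>3 * e\<close>
      under \<open>\<mu> n\<close> and again under \<open>\<nu>\<close>, and the convergence for
      \<open>h\<close> costs one more \<open>e\<close>: in total \<open>7 * e < r\<close>.\<close>
    define e where "e = r / 8"
    have e: "e > 0" using r by (simp add: e_def)
    \<comment> \<open>Makes the tail term \<open>2 * B * C / R^2\<close> at most \<open>e\<close>;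
      the summand 1 keeps \<open>R\<close> positive when \<open>B * C = 0\<close>.\<close>
    define R where "R = sqrt ((2 * B * C + 1) / e)"
    have "(2 * B * C + 1) / e > 0" using B0 C0 e by (simp add: add_nonneg_pos)
    then have R: "R > 0" and R2: "R\<^sup>2 = (2 * B * C + 1) / e" by (simp_all add: R_def)
    have "2 * B * C * e \<le> (2 * B * C + 1) * e" using e by simp
    then have tail: "2 * B * C / R\<^sup>2 \<le> e"
      unfolding R2 using B0 C0 e by (simp add: divide_le_eq mult_ac add_nonneg_pos)
    obtain L where L: "L > 0" "\<And>x. \<bar>f x - f (sin_scale L x)\<bar> \<le> e + 2 * B * (norm x)\<^sup>2 / R\<^sup>2"
      using bounded_continuous_sin_scale_error[OF f B e R] by blast
    obtain p where p: "real_polynomial_function p"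
      "\<And>x. x \<in> cball 0 (real DIM('a) * \<bar>L\<bar>) \<Longrightarrow> \<bar>f x - p x\<bar> < e"
      using Stone_Weierstrass_real_polynomial_function[of "cball 0 (real DIM('a) * \<bar>L\<bar>)" f e]
        continuous_on_subset[OF f] e by auto
    define h where "h = (\<lambda>x. p (sin_scale L x))"
    have h_trig: "trig_poly (\<lambda>x. complex_of_real (h x))"
      unfolding h_def by (rule trig_poly_polynomial_sin_scale) fact
    \<comment> \<open>One \<open>e\<close> stems from \<open>sin_scale\<close>, the other from
      \<open>p\<close>. The second holds for every \<open>x\<close>, however large, because the
      range of \<open>sin_scale L\<close> lies in the ball on which \<open>p\<close> approximates
      \<open>f\<close>.\<close>
    have h_close: "\<bar>f x - h x\<bar> \<le> 2 * e + 2 * B * (norm x)\<^sup>2 / R\<^sup>2" for x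
      using L(2)[of x] p(2)[OF sin_scale_bounded, of x] unfolding h_def by linarith
    have h_int: "integrable \<kappa> h" if "prob_space \<kappa>" "sets \<kappa> = sets borel" for \<kappa>
    proof -
      obtain A where "\<And>x. norm (complex_of_real (h x)) \<le> A" using trig_poly_bounded[OF h_trig] by blast
      moreover have "continuous_on UNIV h"
        using continuous_on_Re[OF continuous_on_trig_poly[OF h_trig]] by simp
      ultimately show ?thesis using integrable_bounded_continuous[OF that, of h A] by simp
    qed
    have close: "\<bar>(\<integral>x. f x \<partial>\<kappa>) - (\<integral>x. h x \<partial>\<kappa>)\<bar> \<le> 3 * e"
      if \<kappa>: "prob_space \<kappa>" "sets \<kappa> = sets borel"
        and m: "integrable \<kappa> (\<lambda>x. (norm x)\<^sup>2)" "(\<integral>x. (norm x)\<^sup>2 \<partial>\<kappa>) \<le> C" for \<kappa>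
    proof -
      interpret \<kappa>: prob_space \<kappa> by fact
      have int: "integrable \<kappa> f" using integrable_bounded_continuous[OF \<kappa> f, of B] B by simp
      have int': "integrable \<kappa> (\<lambda>x. 2 * e + 2 * B * (norm x)\<^sup>2 / R\<^sup>2)" using m(1) by simp
      have "\<bar>(\<integral>x. f x \<partial>\<kappa>) - (\<integral>x. h x \<partial>\<kappa>)\<bar> = \<bar>\<integral>x. f x - h x \<partial>\<kappa>\<bar>"
        using int h_int[OF \<kappa>] by simp
      also have "\<dots> \<le> (\<integral>x. \<bar>f x - h x\<bar> \<partial>\<kappa>)" by (rule integral_abs_bound)
      also have "\<dots> \<le> (\<integral>x. 2 * e + 2 * B * (norm x)\<^sup>2 / R\<^sup>2 \<partial>\<kappa>)"
        using int h_int[OF \<kappa>] int' h_close by (intro integral_mono) auto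
      also have "\<dots> = 2 * e + 2 * B * (\<integral>x. (norm x)\<^sup>2 \<partial>\<kappa>) / R\<^sup>2"
        using m(1) by (simp add: \<kappa>.prob_space)
      also have "\<dots> \<le> 2 * e + 2 * B * C / R\<^sup>2"
        using m(2) B0 by (intro add_left_mono divide_right_mono mult_left_mono) auto
      finally show ?thesis using tail by linarith
    qed
    have "(\<lambda>n. complex_of_real (\<integral>x. h x \<partial>\<mu> n)) \<longlonglongrightarrow> complex_of_real (\<integral>x. h x \<partial>\<nu>)"
      using tendsto_integral_trig_poly[OF \<mu> \<nu> char h_trig] by simp
    then have "(\<lambda>n. \<integral>x. h x \<partial>\<mu> n) \<longlonglongrightarrow> (\<integral>x. h x \<partial>\<nu>)" by (simp add: tendsto_of_real_iff)
    from LIMSEQ_D[OF this e] obtain n0 where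
      n0: "\<And>n. n \<ge> n0 \<Longrightarrow> norm ((\<integral>x. h x \<partial>\<mu> n) - (\<integral>x. h x \<partial>\<nu>)) < e" by blast
    have "norm ((\<integral>x. f x \<partial>\<mu> n) - (\<integral>x. f x \<partial>\<nu>)) < r" if "n \<ge> n0" for n
      using close[OF \<mu>(1,2) mom_\<mu>(1,2), of n] close[OF \<nu> mom_\<nu>] n0[OF that] r
      unfolding e_def real_norm_def by linarith
    then show "\<exists>n0. \<forall>n\<ge>n0. norm ((\<integral>x. f x \<partial>\<mu> n) - (\<integral>x. f x \<partial>\<nu>)) < r" by blast
  qed
qed (use \<mu> \<nu> in auto)


section \<open>Multivariate normal vectors and their characteristic functions\<close>

text \<open>The affine image of a standard normal variable also covers \<open>v = 0\<close>, so
  moments and characteristic functions can be computed below without separating the degenerate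
  case.\<close>

lemma normal_law_eq_distr:
  assumes "v \<ge> 0"
  shows "normal_law \<mu> v = distr std_normal_distribution borel (\<lambda>x. \<mu> + sqrt v * x)"
proof -
  interpret std: real_distribution std_normal_distribution by (rule real_dist_normal_dist)
  show ?thesis
  proof (cases "v = 0")
    case True
    then show ?thesis by (simp add: normal_law_def std.distr_const)
  next
    case False
    have "distributed std_normal_distribution lborel (\<lambda>x. x) (\<lambda>x. ennreal (normal_density 0 1 x))"
      unfolding distributed_def by (auto intro!: distr_id2[symmetric] simp: distr_id2)
    from std.normal_density_affine[OF this, of "sqrt v" \<mu>] assms False
    have "distributed std_normal_distribution lborel (\<lambda>x. \<mu> + sqrt v * x) (\<lambda>x. ennreal (normal_density \<mu> (sqrt v) x))"
      by simp
    from distributed_distr_eq_density[OF this] show ?thesis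
      using False by (simp add: normal_law_def cong: distr_cong)
  qed
qed

lemma real_distribution_normal_law:
  assumes "v \<ge> 0"
  shows "real_distribution (normal_law \<mu> v)"
proof -
  interpret std: real_distribution std_normal_distribution by (rule real_dist_normal_dist)
  show ?thesis unfolding normal_law_eq_distr[OF assms] by (rule std.real_distribution_distr) simp
qed

lemma char_normal_law:
  assumes "v \<ge> 0"
  shows "char (normal_law \<mu> v) t = cis (t * \<mu>) * complex_of_real (exp (- (t\<^sup>2 * v / 2)))"
proof -
  have "char (normal_law \<mu> v) t = (\<integral>x. cis (t * (\<mu> + sqrt v * x)) \<partial>std_normal_distribution)"
    unfolding char_def normal_law_eq_distr[OF assms] cis_conv_exp[symmetric]
    by (subst integral_distr) (auto simp: cis_conv_exp)
  also have "\<dots> = (\<integral>x. cis (t * \<mu>) * cis (t * sqrt v * x) \<partial>std_normal_distribution)"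
    by (simp add: cis_mult algebra_simps)
  also have "\<dots> = cis (t * \<mu>) * char std_normal_distribution (t * sqrt v)"
    unfolding char_def cis_conv_exp[symmetric] by simp
  also have "\<dots> = cis (t * \<mu>) * complex_of_real (exp (- (t\<^sup>2 * v / 2)))"
    using assms by (simp add: char_std_normal_distribution power_mult_distrib)
  finally show ?thesis .
qed

lemma integral_cis_normal_law:
  "v \<ge> 0 \<Longrightarrow> (\<integral>x. cis (t * x) \<partial>normal_law \<mu> v) = cis (t * \<mu>) * complex_of_real (exp (- (t\<^sup>2 * v / 2)))"
  using char_normal_law[of v \<mu> t] by (simp add: char_def cis_conv_exp)

lemma
  assumes "v \<ge> 0"
  shows integrable_normal_law: "integrable (normal_law \<mu> v) (\<lambda>x. x)"
    and integrable_square_normal_law: "integrable (normal_law \<mu> v) (\<lambda>x. x\<^sup>2)"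
    and mean_normal_law: "(\<integral>x. x \<partial>normal_law \<mu> v) = \<mu>"
    and variance_normal_law: "(\<integral>x. (x - \<mu>)\<^sup>2 \<partial>normal_law \<mu> v) = v"
proof -
  define G where "G = std_normal_distribution"
  interpret std: real_distribution G unfolding G_def by (rule real_dist_normal_dist)
  note N = normal_law_eq_distr[OF assms, folded G_def]
  have i1: "integrable G (\<lambda>x. x)" and i2: "integrable G (\<lambda>x. x\<^sup>2)"
    using integrable_std_normal_distribution_moment[of 1] integrable_std_normal_distribution_moment[of 2]
    by (simp_all add: G_def)
  have e1: "(\<integral>x. x \<partial>G) = 0"
    using integral_std_normal_distribution_moment_odd[of 1] by (simp add: G_def)
  have e2: "(\<integral>x. x\<^sup>2 \<partial>G) = 1"
    using std_normal_distribution_even_moments(1)[of 1] by (simp add: G_def)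
  have m: "(\<lambda>x. \<mu> + sqrt v * x) \<in> borel_measurable G" by simp
  have one: "measure G UNIV = 1" using std.prob_space by simp
  have j1: "integrable G (\<lambda>x. \<mu> + sqrt v * x)"
    by (intro Bochner_Integration.integrable_add std.integrable_const integrable_mult_right i1)
  have "integrable G (\<lambda>x. \<mu>\<^sup>2 + v * x\<^sup>2 + (2 * \<mu> * sqrt v) * x)"
    by (intro Bochner_Integration.integrable_add std.integrable_const integrable_mult_right i1 i2)
  moreover have "(\<mu> + sqrt v * x)\<^sup>2 = \<mu>\<^sup>2 + v * x\<^sup>2 + (2 * \<mu> * sqrt v) * x" for x
    using assms by (simp add: power2_sum power_mult_distrib)
  ultimately have j2: "integrable G (\<lambda>x. (\<mu> + sqrt v * x)\<^sup>2)" by simp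
  show "integrable (normal_law \<mu> v) (\<lambda>x. x)"
    unfolding N using j1 integrable_distr_eq[OF m, of "\<lambda>x. x"] by (metis measurable_ident_sets)
  show "integrable (normal_law \<mu> v) (\<lambda>x. x\<^sup>2)"
    unfolding N using j2 integrable_distr_eq[OF m, of "\<lambda>x. x\<^sup>2"] by force
  have "(\<integral>x. x \<partial>normal_law \<mu> v) = (\<integral>x. \<mu> + sqrt v * x \<partial>G)"
    unfolding N by (rule integral_distr[OF m]) measurable
  also have "\<dots> = (\<integral>x. \<mu> \<partial>G) + (\<integral>x. sqrt v * x \<partial>G)"
    by (intro Bochner_Integration.integral_add std.integrable_const integrable_mult_right i1)
  finally show "(\<integral>x. x \<partial>normal_law \<mu> v) = \<mu>"
    using one e1 by simp
  have "(\<integral>x. (x - \<mu>)\<^sup>2 \<partial>normal_law \<mu> v) = (\<integral>x. (\<mu> + sqrt v * x - \<mu>)\<^sup>2 \<partial>G)"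
    unfolding N by (rule integral_distr[OF m]) measurable
  also have "\<dots> = (\<integral>x. v * x\<^sup>2 \<partial>G)"
    using assms by (simp add: power_mult_distrib)
  finally show "(\<integral>x. (x - \<mu>)\<^sup>2 \<partial>normal_law \<mu> v) = v"
    using e2 by simp
qed

lemma
  assumes f [measurable]: "f \<in> borel_measurable M" and d: "distr M borel f = normal_law \<mu> v" and v: "v \<ge> 0"
  shows normal_rv_integrable: "integrable M f"
    and normal_rv_integrable_square: "integrable M (\<lambda>x. (f x)\<^sup>2)"
    and normal_rv_mean: "(\<integral>x. f x \<partial>M) = \<mu>"
    and normal_rv_variance: "(\<integral>x. (f x - \<mu>)\<^sup>2 \<partial>M) = v"
    and normal_rv_char: "(\<integral>x. cis (f x) \<partial>M) = cis \<mu> * complex_of_real (exp (- (v / 2)))"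
proof -
  have id: "(\<lambda>x::real. x) \<in> borel_measurable borel" by simp
  then have dev: "(\<lambda>x. (x - c)\<^sup>2) \<in> borel_measurable borel" for c :: real
    by (intro borel_measurable_power borel_measurable_diff borel_measurable_const)
  have sq: "(\<lambda>x::real. x\<^sup>2) \<in> borel_measurable borel" using dev[of 0] unfolding diff_0_right .
  have cis: "(\<lambda>x. cis x) \<in> borel_measurable borel" by (simp add: cis_conv_exp)
  show "integrable M f"
    using integrable_normal_law[OF v, of \<mu>] unfolding d[symmetric] integrable_distr_eq[OF f id] .
  show "integrable M (\<lambda>x. (f x)\<^sup>2)"
    using integrable_square_normal_law[OF v, of \<mu>] unfolding d[symmetric] integrable_distr_eq[OF f sq] .
  show "(\<integral>x. f x \<partial>M) = \<mu>"
    using mean_normal_law[OF v, of \<mu>] unfolding d[symmetric] integral_distr[OF f id] .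
  show "(\<integral>x. (f x - \<mu>)\<^sup>2 \<partial>M) = v"
    using variance_normal_law[OF v, of \<mu>] unfolding d[symmetric] integral_distr[OF f dev] .
  show "(\<integral>x. cis (f x) \<partial>M) = cis \<mu> * complex_of_real (exp (- (v / 2)))"
    using integral_cis_normal_law[OF v, where \<mu>=\<mu> and t=1] unfolding d[symmetric] mult_1 integral_distr[OF f cis] by simp
qed

lemma multivariate_normal_reindex:
  assumes h: "bij_betw h I J"
    and mn: "multivariate_normal M I (\<lambda>i. X (h i)) (\<lambda>i. m (h i)) (\<lambda>i j. S (h i) (h j))"
  shows "multivariate_normal M J X m S"
proof -
  have J: "J = h ` I" using h by (simp add: bij_betw_def)
  have sum: "(\<Sum>j\<in>J. f j) = (\<Sum>i\<in>I. f (h i))" for f :: "_ \<Rightarrow> real"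
    using sum.reindex_bij_betw[OF h, of f] by simp
  show ?thesis
    using mn unfolding multivariate_normal_def sum unfolding J
    by (auto; erule_tac x="\<lambda>i. a (h i)" in allE; auto)
qed

text \<open>The process is defined through vectors indexed by initial segments of the naturals;
  enumerating the finite type \<open>'p\<close> transports this to points collected in a
  vector.\<close>

lemma centered_gaussian_process_finite:
  fixes P :: "'x^'p"
  assumes "centered_gaussian_process M g k"
  shows "multivariate_normal M UNIV (\<lambda>i. g (P $ i)) (\<lambda>_. 0) (\<lambda>i j. k (P $ i) (P $ j))"
proof -
  obtain h where h: "bij_betw h {..<CARD('p)} (UNIV :: 'p set)"
    using ex_bij_betw_nat_finite[of "UNIV :: 'p set"] by (auto simp: atLeast0LessThan)
  have "multivariate_normal M {..<CARD('p)} (\<lambda>i. g (P $ h i)) (\<lambda>_. 0) (\<lambda>i j. k (P $ h i) (P $ h j))"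
    using assms[unfolded centered_gaussian_process_def, rule_format, of "CARD('p)" "\<lambda>i. P $ h i"] .
  then show ?thesis
    by (intro multivariate_normal_reindex[OF h, where m="\<lambda>_. 0" and S="\<lambda>i j. k (P $ i) (P $ j)"])
qed

text \<open>The moment equations in the definition do not imply integrability, since the Bochner
  integral of a non-integrable function is 0. Integrability is extracted from normality of the
  single coordinates, and products are dominated by sums of squares.\<close>

lemma multivariate_normal_moments:
  fixes X :: "'i::finite \<Rightarrow> 'a \<Rightarrow> real"
  assumes "multivariate_normal M UNIV X m S"
  shows "integrable M (X i)" "integrable M (\<lambda>\<omega>. (X i \<omega>)\<^sup>2)" "integrable M (\<lambda>\<omega>. X i \<omega> * X j \<omega>)"
    "integrable M (\<lambda>\<omega>. (X i \<omega> - m i) * (X j \<omega> - m j))"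
    "(\<integral>\<omega>. (X i \<omega> - m i) * (X j \<omega> - m j) \<partial>M) = S i j" "S i j = S j i"
proof -
  interpret prob_space M using assms by (simp add: multivariate_normal_def)
  note mn = assms[unfolded multivariate_normal_def]
  have [measurable]: "X i \<in> borel_measurable M" for i using mn by simp
  have *: "integrable M (X i) \<and> integrable M (\<lambda>\<omega>. (X i \<omega>)\<^sup>2)" for i
  proof -
    obtain \<mu> v where "v \<ge> 0" "distr M borel (\<lambda>\<omega>. \<Sum>j\<in>UNIV. (if j = i then 1 else 0) * X j \<omega>) = normal_law \<mu> v"
      using mn by meson
    then have v: "v \<ge> 0" and d: "distr M borel (X i) = normal_law \<mu> v"
      by (simp_all add: mult_delta_left)
    show ?thesis using normal_rv_integrable[OF _ d v] normal_rv_integrable_square[OF _ d v] by simp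
  qed
  show i: "integrable M (X i)" "integrable M (\<lambda>\<omega>. (X i \<omega>)\<^sup>2)" for i using * by auto
  show p: "integrable M (\<lambda>\<omega>. X i \<omega> * X j \<omega>)" for i j
  proof (rule Bochner_Integration.integrable_bound)
    show "integrable M (\<lambda>\<omega>. (X i \<omega>)\<^sup>2 + (X j \<omega>)\<^sup>2)" using i by simp
    have "\<bar>a * b\<bar> \<le> a\<^sup>2 + b\<^sup>2" for a b :: real
      using sum_squares_bound[of "\<bar>a\<bar>" "\<bar>b\<bar>"] zero_le_mult_iff[of "\<bar>a\<bar>" "\<bar>b\<bar>"]
      unfolding abs_mult power2_abs by linarith
    then show "AE \<omega> in M. norm (X i \<omega> * X j \<omega>) \<le> norm ((X i \<omega>)\<^sup>2 + (X j \<omega>)\<^sup>2)" by simp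
  qed simp
  show "integrable M (\<lambda>\<omega>. (X i \<omega> - m i) * (X j \<omega> - m j))"
    using i p by (simp add: algebra_simps)
  show S: "(\<integral>\<omega>. (X i \<omega> - m i) * (X j \<omega> - m j) \<partial>M) = S i j" for i j using mn by simp
  show "S i j = S j i" unfolding S[symmetric] by (simp add: mult.commute)
qed

text \<open>The definition only asserts that some normal law exists for each combination. Its
  parameters are the mean and variance of that combination, which are computed by expansion; the
  quadratic form is nonnegative because it is a variance.\<close>

lemma multivariate_normal_linear:
  fixes X :: "'i::finite \<Rightarrow> 'a \<Rightarrow> real" and a :: "'i \<Rightarrow> real"
  assumes mn: "multivariate_normal M UNIV X m S"
  shows "(\<Sum>i\<in>UNIV. \<Sum>j\<in>UNIV. a i * a j * S i j) \<ge> 0"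
    and "distr M borel (\<lambda>\<omega>. \<Sum>i\<in>UNIV. a i * X i \<omega>) =
      normal_law (\<Sum>i\<in>UNIV. a i * m i) (\<Sum>i\<in>UNIV. \<Sum>j\<in>UNIV. a i * a j * S i j)"
proof -
  note mom = multivariate_normal_moments[OF mn]
  have [measurable]: "X i \<in> borel_measurable M" for i using mn by (simp add: multivariate_normal_def)
  have m: "(\<integral>\<omega>. X i \<omega> \<partial>M) = m i" for i using mn by (simp add: multivariate_normal_def)
  obtain \<mu> v where v: "v \<ge> 0" and d: "distr M borel (\<lambda>\<omega>. \<Sum>i\<in>UNIV. a i * X i \<omega>) = normal_law \<mu> v"
    using mn unfolding multivariate_normal_def by meson
  have mu: "\<mu> = (\<Sum>i\<in>UNIV. a i * m i)"
    using normal_rv_mean[OF _ d v] mom(1) m by simp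
  have "v = (\<integral>\<omega>. ((\<Sum>i\<in>UNIV. a i * X i \<omega>) - \<mu>)\<^sup>2 \<partial>M)"
    using normal_rv_variance[OF _ d v] by simp
  also have "\<dots> = (\<integral>\<omega>. (\<Sum>i\<in>UNIV. \<Sum>j\<in>UNIV. a i * a j * ((X i \<omega> - m i) * (X j \<omega> - m j))) \<partial>M)"
    unfolding mu sum_subtractf[symmetric] right_diff_distrib[symmetric] power2_eq_square sum_product
    by (simp add: mult_ac)
  also have "\<dots> = (\<Sum>i\<in>UNIV. \<Sum>j\<in>UNIV. a i * a j * S i j)"
    using mom(4,5) by simp
  finally have "v = (\<Sum>i\<in>UNIV. \<Sum>j\<in>UNIV. a i * a j * S i j)" .
  then show "(\<Sum>i\<in>UNIV. \<Sum>j\<in>UNIV. a i * a j * S i j) \<ge> 0"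
    "distr M borel (\<lambda>\<omega>. \<Sum>i\<in>UNIV. a i * X i \<omega>) =
      normal_law (\<Sum>i\<in>UNIV. a i * m i) (\<Sum>i\<in>UNIV. \<Sum>j\<in>UNIV. a i * a j * S i j)"
    using v d mu by auto
qed

lemma multivariate_normal_char:
  fixes X :: "'i::finite \<Rightarrow> 'a \<Rightarrow> real"
  assumes mn: "multivariate_normal M UNIV X m S"
  shows "(\<integral>\<omega>. cis (\<Sum>i\<in>UNIV. a i * X i \<omega>) \<partial>M) =
    cis (\<Sum>i\<in>UNIV. a i * m i) * complex_of_real (exp (- ((\<Sum>i\<in>UNIV. \<Sum>j\<in>UNIV. a i * a j * S i j) / 2)))"
proof -
  have [measurable]: "X i \<in> borel_measurable M" for i using mn by (simp add: multivariate_normal_def)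
  show ?thesis
    using normal_rv_char[OF _ multivariate_normal_linear(2,1)[OF mn, of a]] by measurable
qed

text \<open>Symmetry of \<open>S\<close> is needed because the quadratic form only determines the symmetric part.\<close>

lemma multivariate_normalI_char:
  fixes X :: "'i::finite \<Rightarrow> 'a \<Rightarrow> real"
  assumes "prob_space M" and X [measurable]: "\<And>i. X i \<in> borel_measurable M"
    and sym: "\<And>i j. S i j = S j i"
    and char: "\<And>a. (\<integral>\<omega>. cis (\<Sum>i\<in>UNIV. a i * X i \<omega>) \<partial>M) =
      cis (\<Sum>i\<in>UNIV. a i * m i) * complex_of_real (exp (- ((\<Sum>i\<in>UNIV. \<Sum>j\<in>UNIV. a i * a j * S i j) / 2)))"
  shows "multivariate_normal M UNIV X m S"
proof -
  interpret prob_space M by fact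
  define Q where "Q a = (\<Sum>i\<in>UNIV. \<Sum>j\<in>UNIV. a i * a j * S i j)" for a
  define T where "T a = (\<lambda>\<omega>. \<Sum>i\<in>UNIV. a i * X i \<omega>)" for a
  have T_meas [measurable]: "T a \<in> borel_measurable M" for a unfolding T_def by measurable
  \<comment> \<open>A characteristic function has modulus at most 1, and here the modulus is
    \<open>exp (- (Q a / 2))\<close>.\<close>
  have Q_nonneg: "Q a \<ge> 0" for a
  proof -
    have "exp (- (Q a / 2)) = norm (\<integral>\<omega>. cis (T a \<omega>) \<partial>M)"
      unfolding T_def char Q_def by (simp add: norm_mult)
    also have "\<dots> \<le> (\<integral>\<omega>. norm (cis (T a \<omega>)) \<partial>M)" by (rule integral_norm_bound)
    also have "\<dots> = 1" by (simp add: prob_space)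
    finally show ?thesis by simp
  qed
  have law: "distr M borel (T a) = normal_law (\<Sum>i\<in>UNIV. a i * m i) (Q a)" for a
  \<comment> \<open>Applying the hypothesis to \<open>t * a\<close> for all real \<open>t\<close>
    gives the whole characteristic function of the single variable \<open>T a\<close>, so
    one-dimensional uniqueness suffices.\<close>
  proof (rule Levy_uniqueness)
    show "char (distr M borel (T a)) = char (normal_law (\<Sum>i\<in>UNIV. a i * m i) (Q a))"
    proof
      fix t
      have "char (distr M borel (T a)) t = (\<integral>\<omega>. cis (t * T a \<omega>) \<partial>M)"
        unfolding char_def cis_conv_exp[symmetric] by (subst integral_distr) (auto simp: cis_conv_exp)
      also have "\<dots> = (\<integral>\<omega>. cis (\<Sum>i\<in>UNIV. (t * a i) * X i \<omega>) \<partial>M)"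
        by (simp add: T_def sum_distrib_left mult_ac)
      also have "\<dots> = cis (t * (\<Sum>i\<in>UNIV. a i * m i)) * complex_of_real (exp (- (t\<^sup>2 * Q a / 2)))"
        unfolding char Q_def by (simp add: sum_distrib_left mult_ac power2_eq_square)
      finally show "char (distr M borel (T a)) t = char (normal_law (\<Sum>i\<in>UNIV. a i * m i) (Q a)) t"
        by (simp add: char_normal_law[OF Q_nonneg])
    qed
  qed (auto intro: real_distribution_distr real_distribution_normal_law Q_nonneg)
  note rv = normal_rv_integrable_square[OF T_meas law Q_nonneg] normal_rv_mean[OF T_meas law Q_nonneg]
    normal_rv_variance[OF T_meas law Q_nonneg] normal_rv_integrable[OF T_meas law Q_nonneg]
  define e where "e i = (\<lambda>j. if j = i then 1 else 0 :: real)" for i :: 'i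
  have e: "T (e i) = X i" "(\<Sum>j\<in>UNIV. e i j * m j) = m i" "Q (e i) = S i i" for i
    by (simp_all add: T_def e_def Q_def mult_delta_left mult_delta_right)
  \<comment> \<open>Polarization: the variance of \<open>X i + X j\<close>, together with the two
    single variances, determines the covariance. Symmetry of \<open>S\<close> merges the two mixed
    terms into \<open>2 * S i j\<close>.\<close>
  have e2: "T (\<lambda>l. e i l + e j l) = (\<lambda>\<omega>. X i \<omega> + X j \<omega>)" "(\<Sum>l\<in>UNIV. (e i l + e j l) * m l) = m i + m j"
    "Q (\<lambda>l. e i l + e j l) = S i i + S j j + 2 * S i j" for i j
  proof -
    show "T (\<lambda>l. e i l + e j l) = (\<lambda>\<omega>. X i \<omega> + X j \<omega>)" "(\<Sum>l\<in>UNIV. (e i l + e j l) * m l) = m i + m j"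
      using e[of i] e[of j] by (auto simp: T_def distrib_right sum.distrib fun_eq_iff)
    have "(\<Sum>l\<in>UNIV. \<Sum>k\<in>UNIV. e i l * e j k * S l k) = S i j" for i j
      by (simp add: e_def mult_delta_left mult_delta_right)
    then show "Q (\<lambda>l. e i l + e j l) = S i i + S j j + 2 * S i j"
      unfolding Q_def using sym[of i j] by (simp add: distrib_right distrib_left sum.distrib)
  qed
  have int: "integrable M (X i)" "integrable M (\<lambda>\<omega>. (X i \<omega>)\<^sup>2)" "expectation (X i) = m i"
    "expectation (\<lambda>\<omega>. (X i \<omega> - m i)\<^sup>2) = S i i" for i
    using rv[of "e i"] by (simp_all add: e)
  have cov: "expectation (\<lambda>\<omega>. (X i \<omega> - m i) * (X j \<omega> - m j)) = S i j" for i j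
  proof -
    let ?f = "\<lambda>i \<omega>. X i \<omega> - m i"
    have sq: "integrable M (\<lambda>\<omega>. (X i \<omega> + X j \<omega>)\<^sup>2)"
      "expectation (\<lambda>\<omega>. (X i \<omega> + X j \<omega> - (m i + m j))\<^sup>2) = S i i + S j j + 2 * S i j"
      using rv[of "\<lambda>l. e i l + e j l"] by (simp_all add: e2)
    have i1: "integrable M (\<lambda>\<omega>. (X i \<omega> + X j \<omega> - (m i + m j))\<^sup>2)"
      using sq(1) int(1)[of i] int(1)[of j] unfolding power2_diff by simp
    have i2: "integrable M (\<lambda>\<omega>. (?f i \<omega>)\<^sup>2)" for i using int[of i] unfolding power2_diff by simp
    have "expectation (\<lambda>\<omega>. ?f i \<omega> * ?f j \<omega>) =
        expectation (\<lambda>\<omega>. ((X i \<omega> + X j \<omega> - (m i + m j))\<^sup>2 - (?f i \<omega>)\<^sup>2 - (?f j \<omega>)\<^sup>2) / 2)"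
      by (intro Bochner_Integration.integral_cong) (auto simp: power2_eq_square algebra_simps)
    also have "\<dots> = S i j" using i1 i2 int(4) sq(2) by simp
    finally show ?thesis .
  qed
  show ?thesis unfolding multivariate_normal_def
  proof (intro conjI ballI allI)
    show "\<exists>\<mu> v. 0 \<le> v \<and> distr M borel (\<lambda>\<omega>. \<Sum>i\<in>UNIV. a i * X i \<omega>) = normal_law \<mu> v" for a
      using law[of a] Q_nonneg[of a] unfolding T_def by blast
  qed (use int cov prob_space_axioms in auto)
qed


section \<open>Gaussian vectors tilted by Gaussian observations\<close>

text \<open>The characteristic function of the standard normal law, read backwards: a Gaussian
  factor in \<open>u\<close> is an average of characters of \<open>u\<close>.\<close>

lemma exp_neg_square_eq_integral_cis:
  "complex_of_real (exp (- (u\<^sup>2 / 2))) = (\<integral>\<xi>. cis (u * \<xi>) \<partial>std_normal_distribution)"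
  using char_std_normal_distribution by (simp add: char_def cis_conv_exp fun_eq_iff)

text \<open>Completing the square absorbs the real exponential into a shifted normal density.\<close>

lemma integral_std_normal_tilt:
  fixes \<alpha> \<beta> \<gamma> :: real
  assumes "\<gamma> \<ge> 0"
  defines "q \<equiv> 1 + \<gamma>"
  shows "(\<integral>\<xi>. cis (\<alpha> * \<xi>) * complex_of_real (exp (\<beta> * \<xi> - \<gamma> * \<xi>\<^sup>2 / 2)) \<partial>std_normal_distribution) =
    complex_of_real (exp (- (\<alpha>\<^sup>2 / (2 * q))) / sqrt q) * (cis (\<alpha> * \<beta> / q) * complex_of_real (exp (\<beta>\<^sup>2 / (2 * q))))"
proof -
  have q: "q > 0" using assms by simp
  \<comment> \<open>The tilted density is a multiple of the normal density with mean
    \<open>\<beta> / q\<close> and variance \<open>1 / q\<close>; the quotient of the two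
    normalizing constants leaves \<open>1 / sqrt q\<close>.\<close>
  have dens: "std_normal_density \<xi> * exp (\<beta> * \<xi> - \<gamma> * \<xi>\<^sup>2 / 2) =
      (exp (\<beta>\<^sup>2 / (2 * q)) / sqrt q) * normal_density (\<beta> / q) (sqrt (1 / q)) \<xi>" for \<xi>
  proof -
    have "- \<xi>\<^sup>2 / 2 + (\<beta> * \<xi> - \<gamma> * \<xi>\<^sup>2 / 2) = \<beta>\<^sup>2 / (2 * q) + - (\<xi> - \<beta> / q)\<^sup>2 / (2 * (1 / q))"
      using q by (simp add: power2_eq_square field_simps) (simp add: q_def algebra_simps)
    then have "exp (- \<xi>\<^sup>2 / 2) * exp (\<beta> * \<xi> - \<gamma> * \<xi>\<^sup>2 / 2) = exp (\<beta>\<^sup>2 / (2 * q)) * exp (- (\<xi> - \<beta> / q)\<^sup>2 / (2 * (1 / q)))"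
      by (simp only: exp_add[symmetric])
    then show ?thesis
      using q unfolding std_normal_density_def normal_density_def
      by (simp add: real_sqrt_divide real_sqrt_mult field_simps)
  qed
  have "(\<integral>\<xi>. cis (\<alpha> * \<xi>) * complex_of_real (exp (\<beta> * \<xi> - \<gamma> * \<xi>\<^sup>2 / 2)) \<partial>std_normal_distribution) =
      (\<integral>\<xi>. std_normal_density \<xi> *\<^sub>R (cis (\<alpha> * \<xi>) * complex_of_real (exp (\<beta> * \<xi> - \<gamma> * \<xi>\<^sup>2 / 2))) \<partial>lborel)"
    by (rule integral_density) (auto simp: cis_conv_exp)
  also have "\<dots> = (\<integral>\<xi>. complex_of_real (exp (\<beta>\<^sup>2 / (2 * q)) / sqrt q) *
      (normal_density (\<beta> / q) (sqrt (1 / q)) \<xi> *\<^sub>R cis (\<alpha> * \<xi>)) \<partial>lborel)"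
  proof (rule Bochner_Integration.integral_cong[OF refl])
    fix \<xi>
    have "std_normal_density \<xi> *\<^sub>R (cis (\<alpha> * \<xi>) * complex_of_real (exp (\<beta> * \<xi> - \<gamma> * \<xi>\<^sup>2 / 2))) =
        (std_normal_density \<xi> * exp (\<beta> * \<xi> - \<gamma> * \<xi>\<^sup>2 / 2)) *\<^sub>R cis (\<alpha> * \<xi>)"
      by (simp add: scaleR_conv_of_real mult_ac)
    then show "std_normal_density \<xi> *\<^sub>R (cis (\<alpha> * \<xi>) * complex_of_real (exp (\<beta> * \<xi> - \<gamma> * \<xi>\<^sup>2 / 2))) =
        complex_of_real (exp (\<beta>\<^sup>2 / (2 * q)) / sqrt q) * (normal_density (\<beta> / q) (sqrt (1 / q)) \<xi> *\<^sub>R cis (\<alpha> * \<xi>))"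
      unfolding dens by (simp add: scaleR_conv_of_real)
  qed
  also have "\<dots> = complex_of_real (exp (\<beta>\<^sup>2 / (2 * q)) / sqrt q) *
      (\<integral>\<xi>. normal_density (\<beta> / q) (sqrt (1 / q)) \<xi> *\<^sub>R cis (\<alpha> * \<xi>) \<partial>lborel)"
    by (rule integral_mult_right_zero)
  also have "(\<integral>\<xi>. normal_density (\<beta> / q) (sqrt (1 / q)) \<xi> *\<^sub>R cis (\<alpha> * \<xi>) \<partial>lborel) =
      (\<integral>\<xi>. cis (\<alpha> * \<xi>) \<partial>normal_law (\<beta> / q) (1 / q))"
  proof -
    have "normal_law (\<beta> / q) (1 / q) = density lborel (\<lambda>\<xi>. ennreal (normal_density (\<beta> / q) (sqrt (1 / q)) \<xi>))"
      using q by (simp add: normal_law_def)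
    then show ?thesis
      by (simp only:) (rule integral_density[symmetric], auto simp: cis_conv_exp)
  qed
  also have "\<dots> = cis (\<alpha> * (\<beta> / q)) * complex_of_real (exp (- (\<alpha>\<^sup>2 * (1 / q) / 2)))"
    using q by (intro integral_cis_normal_law) simp
  finally show ?thesis by (simp add: mult_ac)
qed

text \<open>Expands the form at \<open>a\<close> minus \<open>c\<close> times the
  \<open>i\<close>-th unit vector; symmetry makes the two cross terms equal.\<close>

lemma quadratic_form_shift:
  fixes S :: "'i::finite \<Rightarrow> 'i \<Rightarrow> real"
  assumes sym: "\<And>j l. S j l = S l j"
  shows "(\<Sum>j\<in>UNIV. \<Sum>l\<in>UNIV. (a j - c * (if j = i then 1 else 0)) * (a l - c * (if l = i then 1 else 0)) * S j l) =
    (\<Sum>j\<in>UNIV. \<Sum>l\<in>UNIV. a j * a l * S j l) - 2 * c * (\<Sum>j\<in>UNIV. a j * S j i) + c\<^sup>2 * S i i"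
proof -
  have "(a j - c * (if j = i then 1 else 0)) * (a l - c * (if l = i then 1 else 0)) * S j l =
      a j * a l * S j l - (if j = i then c * (a l * S i l) else 0) - (if l = i then c * (a j * S j i) else 0)
      + (if j = i then if l = i then c\<^sup>2 * S i i else 0 else 0)" for j l
    by (simp add: algebra_simps power2_eq_square)
  then have "(\<Sum>j\<in>UNIV. \<Sum>l\<in>UNIV. (a j - c * (if j = i then 1 else 0)) * (a l - c * (if l = i then 1 else 0)) * S j l) =
    (\<Sum>j\<in>UNIV. \<Sum>l\<in>UNIV. a j * a l * S j l) - (\<Sum>l\<in>UNIV. \<Sum>j\<in>UNIV. if j = i then c * (a l * S i l) else 0)
     - (\<Sum>j\<in>UNIV. \<Sum>l\<in>UNIV. if l = i then c * (a j * S j i) else 0)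
     + (\<Sum>l\<in>UNIV. \<Sum>j\<in>UNIV. if j = i then if l = i then c\<^sup>2 * S i i else 0 else 0)"
    \<comment> \<open>The swaps put the summation over an index pinned to \<open>i\<close>
      innermost, where the next step can evaluate it.\<close>
    by (simp only: sum_subtractf sum.distrib)
       (subst (2 5) sum.swap, rule refl)
  also have "\<dots> = (\<Sum>j\<in>UNIV. \<Sum>l\<in>UNIV. a j * a l * S j l) - c * (\<Sum>l\<in>UNIV. a l * S i l)
     - c * (\<Sum>j\<in>UNIV. a j * S j i) + c\<^sup>2 * S i i"
    by (simp add: sum_distrib_left)
  also have "(\<Sum>l\<in>UNIV. a l * S i l) = (\<Sum>j\<in>UNIV. a j * S j i)" by (simp add: sym[of i])
  finally show ?thesis by simp
qed

text \<open>Says that \<open>X\<close> under the unnormalized measure with density \<open>w\<close>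
  is Gaussian of total mass \<open>Z\<close>. The characteristic function expresses this without a
  density for \<open>X\<close>, so singular \<open>S\<close> is allowed; symmetry is included
  because the quadratic form does not see the antisymmetric part of \<open>S\<close>.\<close>

definition tilted_gaussian ::
  "'a measure \<Rightarrow> ('a \<Rightarrow> real) \<Rightarrow> ('i::finite \<Rightarrow> 'a \<Rightarrow> real) \<Rightarrow> ('i \<Rightarrow> real) \<Rightarrow> ('i \<Rightarrow> 'i \<Rightarrow> real) \<Rightarrow> real \<Rightarrow> bool" where
  "tilted_gaussian M w X m S Z \<longleftrightarrow> (\<forall>j l. S j l = S l j) \<and>
    (\<forall>a. (\<integral>\<omega>. complex_of_real (w \<omega>) * cis (\<Sum>j\<in>UNIV. a j * X j \<omega>) \<partial>M) =
      complex_of_real Z * (cis (\<Sum>j\<in>UNIV. a j * m j) *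
        complex_of_real (exp (- ((\<Sum>j\<in>UNIV. \<Sum>l\<in>UNIV. a j * a l * S j l) / 2)))))"

lemma tilted_gaussian_total:
  assumes "tilted_gaussian M w X m S Z"
  shows "(\<integral>\<omega>. w \<omega> \<partial>M) = Z"
proof -
  have "(\<integral>\<omega>. complex_of_real (w \<omega>) \<partial>M) = complex_of_real Z"
    using assms[unfolded tilted_gaussian_def, THEN conjunct2, rule_format, of "\<lambda>_. 0"] by simp
  then show ?thesis by (simp del: of_real_eq_iff add: of_real_eq_iff[symmetric, where 'a=complex])
qed

text \<open>The modulus of the transform at the \<open>i\<close>-th unit vector is at most the total
  mass \<open>Z\<close>. This makes the denominators \<open>S i i + \<sigma>^2\<close> of the
  updates positive.\<close>

lemma tilted_gaussian_nonneg:
  fixes X :: "'i::finite \<Rightarrow> 'a \<Rightarrow> real"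
  assumes tg: "tilted_gaussian M w X m S Z" and Z: "Z > 0" and w: "\<And>\<omega>. w \<omega> \<ge> 0"
  shows "S i i \<ge> 0"
proof -
  let ?e = "\<lambda>j. if j = i then 1 else 0 :: real"
  have "Z * exp (- (S i i / 2)) = norm (\<integral>\<omega>. complex_of_real (w \<omega>) * cis (\<Sum>j\<in>UNIV. ?e j * X j \<omega>) \<partial>M)"
    unfolding tg[unfolded tilted_gaussian_def, THEN conjunct2, rule_format]
    using Z by (simp add: norm_mult mult_delta_left mult_delta_right)
  also have "\<dots> \<le> (\<integral>\<omega>. norm (complex_of_real (w \<omega>) * cis (\<Sum>j\<in>UNIV. ?e j * X j \<omega>)) \<partial>M)"
    by (rule integral_norm_bound)
  also have "\<dots> = Z" using tilted_gaussian_total[OF tg] w by (simp add: norm_mult)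
  finally show ?thesis using Z by simp
qed

text \<open>The Gaussian factor is itself an average of characters \<open>cis (\<xi> (y - X i) / \<sigma>)\<close>, so tilting by
  it averages the known characteristic function of \<open>X\<close> along a line.\<close>

lemma tilted_gaussian_step:
  fixes X :: "'i::finite \<Rightarrow> 'a \<Rightarrow> real" and i :: 'i and \<sigma> y :: real
  assumes "prob_space M" and X [measurable]: "\<And>i. X i \<in> borel_measurable M"
    and w_meas [measurable]: "w \<in> borel_measurable M" and w: "\<And>\<omega>. w \<omega> \<ge> 0" "\<And>\<omega>. w \<omega> \<le> 1"
    and tg: "tilted_gaussian M w X m S Z" and Z: "Z > 0" and \<sigma>: "\<sigma> > 0"
  defines "q \<equiv> S i i + \<sigma>\<^sup>2"
  obtains Z' where "Z' > 0" "tilted_gaussian M (\<lambda>\<omega>. w \<omega> * exp (- ((y - X i \<omega>)\<^sup>2 / (2 * \<sigma>\<^sup>2)))) X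
    (\<lambda>j. m j + S j i * (y - m i) / q) (\<lambda>j l. S j l - S j i * S i l / q) Z'"
proof -
  interpret prob_space M by fact
  define G where "G = std_normal_distribution"
  interpret std: real_distribution G unfolding G_def by (rule real_dist_normal_dist)
  interpret pair_prob_space M G ..
  have sym: "\<And>j l. S j l = S l j" using tg by (simp add: tilted_gaussian_def)
  define Q where "Q a = (\<Sum>j\<in>UNIV. \<Sum>l\<in>UNIV. a j * a l * S j l)" for a
  define mu where "mu a = (\<Sum>j\<in>UNIV. a j * m j)" for a
  have char: "(\<integral>\<omega>. complex_of_real (w \<omega>) * cis (\<Sum>j\<in>UNIV. a j * X j \<omega>) \<partial>M) =
      complex_of_real Z * (cis (mu a) * complex_of_real (exp (- (Q a / 2))))" for a
    using tg unfolding tilted_gaussian_def Q_def mu_def by blast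
  have Sii: "S i i \<ge> 0" by (rule tilted_gaussian_nonneg[OF tg Z w(1)])
  then have q: "q > 0" using \<sigma> by (simp add: q_def add_nonneg_pos)
  define \<gamma> where "\<gamma> = S i i / \<sigma>\<^sup>2"
  have \<gamma>: "\<gamma> \<ge> 0" using Sii by (simp add: \<gamma>_def)
  have q\<gamma>: "1 + \<gamma> = q / \<sigma>\<^sup>2" using \<sigma> by (simp add: \<gamma>_def q_def field_simps)
  define \<alpha> where "\<alpha> = (y - m i) / \<sigma>"
  \<comment> \<open>The quotient \<open>Z' / Z\<close> is the mean of the new factor when
    \<open>X i\<close> is normal with mean \<open>m i\<close> and variance
    \<open>S i i\<close>.\<close>
  define Z' where "Z' = Z * (exp (- (\<alpha>\<^sup>2 / (2 * (1 + \<gamma>)))) / sqrt (1 + \<gamma>))"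
  have Z': "Z' > 0" using Z \<gamma> by (simp add: Z'_def)
  have "(\<integral>\<omega>. complex_of_real (w \<omega> * exp (- ((y - X i \<omega>)\<^sup>2 / (2 * \<sigma>\<^sup>2)))) * cis (\<Sum>j\<in>UNIV. a j * X j \<omega>) \<partial>M) =
      complex_of_real Z' * (cis (\<Sum>j\<in>UNIV. a j * (m j + S j i * (y - m i) / q)) *
        complex_of_real (exp (- ((\<Sum>j\<in>UNIV. \<Sum>l\<in>UNIV. a j * a l * (S j l - S j i * S i l / q)) / 2))))"
    (is "?lhs = ?rhs") for a
  proof -
    define \<beta> where "\<beta> = (\<Sum>j\<in>UNIV. a j * S j i) / \<sigma>"
    \<comment> \<open>The part of the character that depends on \<open>X i\<close> is absorbed by
      lowering coefficient \<open>i\<close> by \<open>\<xi> / \<sigma>\<close>, so the known formula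
      applies at \<open>b \<xi>\<close>.\<close>
    define b where "b \<xi> = (\<lambda>j. a j - \<xi> / \<sigma> * (if j = i then 1 else 0))" for \<xi>
    have b_sum: "(\<Sum>j\<in>UNIV. b \<xi> j * f j) = (\<Sum>j\<in>UNIV. a j * f j) - \<xi> / \<sigma> * f i" for \<xi> f
      by (simp add: b_def left_diff_distrib sum_subtractf mult_delta_left mult_delta_right)
    \<comment> \<open>Along this line the form is a quadratic polynomial in \<open>\<xi>\<close>.
      Its coefficients \<open>\<beta>\<close> and \<open>\<gamma>\<close>, with the linear phase
      \<open>\<alpha>\<close>, are scaled to match \<open>integral_std_normal_tilt\<close>.\<close>
    have Qb: "Q (b \<xi>) = Q a - 2 * (\<beta> * \<xi> - \<gamma> * \<xi>\<^sup>2 / 2)" for \<xi>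
    proof -
      have "Q (b \<xi>) = Q a - 2 * (\<xi> / \<sigma>) * (\<Sum>j\<in>UNIV. a j * S j i) + (\<xi> / \<sigma>)\<^sup>2 * S i i"
        unfolding Q_def b_def by (rule quadratic_form_shift) (rule sym)
      then show ?thesis using \<sigma> by (simp add: \<beta>_def \<gamma>_def power_divide field_simps)
    qed
    let ?H = "\<lambda>\<omega> \<xi>. complex_of_real (w \<omega>) * cis (\<Sum>j\<in>UNIV. b \<xi> j * X j \<omega>) * cis (y / \<sigma> * \<xi>)"
    have H_meas: "(\<lambda>(\<omega>, \<xi>). ?H \<omega> \<xi>) \<in> borel_measurable (M \<Otimes>\<^sub>M G)"
      unfolding cis_conv_exp b_sum by measurable
    have "?lhs = (\<integral>\<omega>. (\<integral>\<xi>. ?H \<omega> \<xi> \<partial>G) \<partial>M)"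
    proof (rule Bochner_Integration.integral_cong[OF refl])
      fix \<omega>
      define u where "u = (y - X i \<omega>) / \<sigma>"
      have "complex_of_real (exp (- ((y - X i \<omega>)\<^sup>2 / (2 * \<sigma>\<^sup>2)))) = (\<integral>\<xi>. cis (u * \<xi>) \<partial>G)"
        unfolding G_def exp_neg_square_eq_integral_cis[symmetric] u_def by (simp add: power_divide mult.commute)
      then have "complex_of_real (w \<omega> * exp (- ((y - X i \<omega>)\<^sup>2 / (2 * \<sigma>\<^sup>2)))) * cis (\<Sum>j\<in>UNIV. a j * X j \<omega>) =
          (\<integral>\<xi>. complex_of_real (w \<omega>) * cis (\<Sum>j\<in>UNIV. a j * X j \<omega>) * cis (u * \<xi>) \<partial>G)"
        by (simp add: mult_ac)
      also have "\<dots> = (\<integral>\<xi>. ?H \<omega> \<xi> \<partial>G)"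
        unfolding b_sum u_def mult.assoc cis_mult
        by (intro Bochner_Integration.integral_cong refl arg_cong2[of _ _ _ _ "(*)"] arg_cong[of _ _ cis])
           (simp add: diff_divide_distrib algebra_simps)
      finally show "complex_of_real (w \<omega> * exp (- ((y - X i \<omega>)\<^sup>2 / (2 * \<sigma>\<^sup>2)))) * cis (\<Sum>j\<in>UNIV. a j * X j \<omega>) =
          (\<integral>\<xi>. ?H \<omega> \<xi> \<partial>G)" .
    qed
    also have "\<dots> = (\<integral>\<xi>. (\<integral>\<omega>. ?H \<omega> \<xi> \<partial>M) \<partial>G)"
    \<comment> \<open>The integrand has modulus at most 1 because \<open>w\<close> does, and the
      product measure is a probability measure.\<close>
    proof (rule Fubini_integral[symmetric])
      show "integrable (M \<Otimes>\<^sub>M G) (\<lambda>(\<omega>, \<xi>). ?H \<omega> \<xi>)"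
        by (rule integrable_const_bound[of _ 1]) (use H_meas w in \<open>auto simp: norm_mult\<close>)
    qed
    also have "\<dots> = (\<integral>\<xi>. complex_of_real Z * (cis (mu a) * complex_of_real (exp (- (Q a / 2)))) *
        (cis (\<alpha> * \<xi>) * complex_of_real (exp (\<beta> * \<xi> - \<gamma> * \<xi>\<^sup>2 / 2))) \<partial>G)"
    proof (rule Bochner_Integration.integral_cong[OF refl])
      fix \<xi>
      have "(\<integral>\<omega>. ?H \<omega> \<xi> \<partial>M) = complex_of_real Z * (cis (mu (b \<xi>)) * complex_of_real (exp (- (Q (b \<xi>) / 2))) * cis (y / \<sigma> * \<xi>))"
        unfolding mult.assoc[symmetric, of _ _ "cis (y / \<sigma> * \<xi>)"] char[symmetric] by (rule integral_mult_left_zero)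
      also have "cis (mu (b \<xi>)) * complex_of_real (exp (- (Q (b \<xi>) / 2))) * cis (y / \<sigma> * \<xi>) =
          cis (mu a) * complex_of_real (exp (- (Q a / 2))) * (cis (\<alpha> * \<xi>) * complex_of_real (exp (\<beta> * \<xi> - \<gamma> * \<xi>\<^sup>2 / 2)))"
      proof -
        have "cis (mu (b \<xi>)) * cis (y / \<sigma> * \<xi>) = cis (mu a) * cis (\<alpha> * \<xi>)"
          unfolding cis_mult mu_def b_sum \<alpha>_def by (simp add: diff_divide_distrib algebra_simps)
        moreover have "exp (- (Q (b \<xi>) / 2)) = exp (- (Q a / 2)) * exp (\<beta> * \<xi> - \<gamma> * \<xi>\<^sup>2 / 2)"
          unfolding Qb exp_add[symmetric] by (simp add: diff_divide_distrib)
        ultimately show ?thesis by (simp add: mult_ac)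
      qed
      finally show "(\<integral>\<omega>. ?H \<omega> \<xi> \<partial>M) = complex_of_real Z * (cis (mu a) * complex_of_real (exp (- (Q a / 2)))) *
        (cis (\<alpha> * \<xi>) * complex_of_real (exp (\<beta> * \<xi> - \<gamma> * \<xi>\<^sup>2 / 2)))" by (simp add: mult.assoc)
    qed
    also have "\<dots> = complex_of_real Z * (cis (mu a) * complex_of_real (exp (- (Q a / 2)))) *
        (complex_of_real (exp (- (\<alpha>\<^sup>2 / (2 * (1 + \<gamma>)))) / sqrt (1 + \<gamma>)) *
          (cis (\<alpha> * \<beta> / (1 + \<gamma>)) * complex_of_real (exp (\<beta>\<^sup>2 / (2 * (1 + \<gamma>))))))"
      unfolding integral_std_normal_tilt[OF \<gamma>, symmetric] G_def by (rule integral_mult_right_zero)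
    also have "\<dots> = complex_of_real Z' * ((cis (mu a) * cis (\<alpha> * \<beta> / (1 + \<gamma>))) *
        complex_of_real (exp (- (Q a / 2)) * exp (\<beta>\<^sup>2 / (2 * (1 + \<gamma>)))))"
      by (simp add: Z'_def)
    \<comment> \<open>With \<open>1 + \<gamma> = q / \<sigma>^2\<close>, the phase of the integral
      becomes the shift of the mean; below, the factor
      \<open>exp (\<beta>^2 / (2 * (1 + \<gamma>)))\<close> becomes the rank-one decrease of the
      covariance.\<close>
    also have "cis (mu a) * cis (\<alpha> * \<beta> / (1 + \<gamma>)) = cis (\<Sum>j\<in>UNIV. a j * (m j + S j i * (y - m i) / q))"
    proof -
      have "\<alpha> * \<beta> / (1 + \<gamma>) = (\<Sum>j\<in>UNIV. a j * S j i) * ((y - m i) / q)"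
        using \<sigma> q unfolding q\<gamma> \<alpha>_def \<beta>_def by (simp add: power2_eq_square)
      also have "\<dots> = (\<Sum>j\<in>UNIV. a j * (S j i * (y - m i) / q))"
        unfolding sum_distrib_right by (simp add: mult_ac)
      finally show ?thesis unfolding cis_mult mu_def by (simp add: distrib_left sum.distrib)
    qed
    also have "exp (- (Q a / 2)) * exp (\<beta>\<^sup>2 / (2 * (1 + \<gamma>))) =
        exp (- ((\<Sum>j\<in>UNIV. \<Sum>l\<in>UNIV. a j * a l * (S j l - S j i * S i l / q)) / 2))"
    proof -
      have "\<beta>\<^sup>2 / (1 + \<gamma>) = (\<Sum>j\<in>UNIV. a j * S j i) * (\<Sum>l\<in>UNIV. a l * S l i) / q"
        using \<sigma> q unfolding q\<gamma> \<beta>_def by (simp add: power2_eq_square)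
      also have "\<dots> = (\<Sum>j\<in>UNIV. \<Sum>l\<in>UNIV. a j * a l * (S j i * S i l / q))"
        unfolding sum_product sum_divide_distrib sym[of i] by (simp add: mult_ac)
      finally have \<beta>: "\<beta>\<^sup>2 / (1 + \<gamma>) = (\<Sum>j\<in>UNIV. \<Sum>l\<in>UNIV. a j * a l * (S j i * S i l / q))" .
      have "\<beta>\<^sup>2 / (2 * (1 + \<gamma>)) = \<beta>\<^sup>2 / (1 + \<gamma>) / 2" by (simp only: divide_divide_eq_left mult.commute)
      then show ?thesis
        unfolding exp_add[symmetric] Q_def \<beta> by (simp add: right_diff_distrib sum_subtractf diff_divide_distrib)
    qed
    finally show ?thesis .
  qed
  then have "tilted_gaussian M (\<lambda>\<omega>. w \<omega> * exp (- ((y - X i \<omega>)\<^sup>2 / (2 * \<sigma>\<^sup>2)))) X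
    (\<lambda>j. m j + S j i * (y - m i) / q) (\<lambda>j l. S j l - S j i * S i l / q) Z'"
    unfolding tilted_gaussian_def using sym by (auto simp: mult_ac)
  then show thesis using that Z' by blast
qed

text \<open>The recursion for the updated mean and covariance is kept in the implicit form of the normal
  equations, which is stable under adding one more observation.\<close>

lemma tilted_gaussian_observations:
  fixes X :: "'i::finite \<Rightarrow> 'a \<Rightarrow> real"
  assumes "prob_space M" and X [measurable]: "\<And>i. X i \<in> borel_measurable M"
    and tg: "tilted_gaussian M (\<lambda>_. 1) X m S 1" and \<sigma>: "\<sigma> > 0" and J: "finite J"
  shows "\<exists>m' S' Z. Z > 0 \<and> tilted_gaussian M (\<lambda>\<omega>. \<Prod>j\<in>J. exp (- ((y j - X j \<omega>)\<^sup>2 / (2 * \<sigma>\<^sup>2)))) X m' S' Z \<and>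
    (\<forall>a. m' a = m a + (\<Sum>j\<in>J. S a j * ((y j - m' j) / \<sigma>\<^sup>2))) \<and>
    (\<forall>a b. S' a b = S a b - (\<Sum>j\<in>J. S a j * (S' j b / \<sigma>\<^sup>2)))"
  using J
proof (induction J rule: finite_induct)
  case empty
  show ?case using tg by (intro exI[of _ m] exI[of _ S] exI[of _ 1]) simp
next
  case (insert i J)
  define w where "w = (\<lambda>\<omega>. \<Prod>j\<in>J. exp (- ((y j - X j \<omega>)\<^sup>2 / (2 * \<sigma>\<^sup>2))))"
  have [measurable]: "w \<in> borel_measurable M" unfolding w_def by measurable
  have w: "w \<omega> \<ge> 0" "w \<omega> \<le> 1" for \<omega>
    unfolding w_def by (auto intro!: prod_nonneg prod_le_1)
  obtain m' S' Z where Z: "Z > 0" and tg': "tilted_gaussian M w X m' S' Z"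
    and m': "\<And>a. m' a = m a + (\<Sum>j\<in>J. S a j * ((y j - m' j) / \<sigma>\<^sup>2))"
    and S': "\<And>a b. S' a b = S a b - (\<Sum>j\<in>J. S a j * (S' j b / \<sigma>\<^sup>2))"
    using insert.IH unfolding w_def by blast
  define q where "q = S' i i + \<sigma>\<^sup>2"
  have q: "q > 0" using tilted_gaussian_nonneg[OF tg' Z w(1), of i] \<sigma> by (simp add: q_def add_nonneg_pos)
  \<comment> \<open>This will equal the new residual \<open>(y i - m'' i) / \<sigma>^2\<close>,
    hence the coefficient that the enlarged sum gains at \<open>i\<close>.\<close>
  define \<kappa> where "\<kappa> = (y i - m' i) / q"
  define m'' where "m'' = (\<lambda>j. m' j + S' j i * (y i - m' i) / q)"
  define S'' where "S'' = (\<lambda>j l. S' j l - S' j i * S' i l / q)"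
  obtain Z' where "Z' > 0" and tg'': "tilted_gaussian M (\<lambda>\<omega>. w \<omega> * exp (- ((y i - X i \<omega>)\<^sup>2 / (2 * \<sigma>\<^sup>2)))) X m'' S'' Z'"
    using tilted_gaussian_step[OF assms(1) X _ w tg' Z \<sigma>, where i=i and y="y i"] unfolding m''_def S''_def q_def by auto
  have w_insert: "(\<lambda>\<omega>. w \<omega> * exp (- ((y i - X i \<omega>)\<^sup>2 / (2 * \<sigma>\<^sup>2)))) =
      (\<lambda>\<omega>. \<Prod>j\<in>insert i J. exp (- ((y j - X j \<omega>)\<^sup>2 / (2 * \<sigma>\<^sup>2))))"
    using insert.hyps by (simp add: w_def mult.commute)
  have S_sum: "(\<Sum>j\<in>J. S a j * (S' j b / \<sigma>\<^sup>2)) = S a b - S' a b" for a b using S'[of a b] by simp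
  have "m'' a = m a + (\<Sum>j\<in>insert i J. S a j * ((y j - m'' j) / \<sigma>\<^sup>2))" for a
  proof -
    have m''_\<kappa>: "m'' j = m' j + \<kappa> * S' j i" for j by (simp add: m''_def \<kappa>_def)
    \<comment> \<open>Each old residual drops by \<open>\<kappa> * S' j i\<close>. By
      \<open>S_sum\<close> these corrections add up to \<open>\<kappa> * (S a i - S' a i)\<close>;
      the new summand restores \<open>\<kappa> * S a i\<close>, leaving exactly the update of the
      mean.\<close>
    have "(\<Sum>j\<in>J. S a j * ((y j - m'' j) / \<sigma>\<^sup>2)) =
        (\<Sum>j\<in>J. S a j * ((y j - m' j) / \<sigma>\<^sup>2)) - \<kappa> * (\<Sum>j\<in>J. S a j * (S' j i / \<sigma>\<^sup>2))"
      unfolding m''_\<kappa> by (simp add: sum_distrib_left sum_subtractf[symmetric] diff_divide_distrib add_divide_distrib algebra_simps)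
    moreover have "(y i - m'' i) / \<sigma>\<^sup>2 = \<kappa>"
    proof -
      have "y i - m' i = \<kappa> * q" using q by (simp add: \<kappa>_def)
      then show ?thesis using \<sigma> by (simp add: m''_\<kappa> q_def field_simps)
    qed
    moreover have "(\<Sum>j\<in>J. S a j * ((y j - m' j) / \<sigma>\<^sup>2)) = m' a - m a" using m'[of a] by simp
    ultimately show ?thesis
      unfolding sum.insert[OF insert.hyps] S_sum by (simp only: m''_\<kappa>[of a]) (simp only: algebra_simps)
  qed
  moreover have "S'' a b = S a b - (\<Sum>j\<in>insert i J. S a j * (S'' j b / \<sigma>\<^sup>2))" for a b
  proof -
    \<comment> \<open>Has the role of \<open>\<kappa>\<close> for column \<open>b\<close> of the
      covariance: it equals \<open>S'' i b / \<sigma>^2\<close>, and the same cancellation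
      follows.\<close>
    define \<tau> where "\<tau> = S' i b / q"
    have S''_\<tau>: "S'' j b = S' j b - \<tau> * S' j i" for j by (simp add: S''_def \<tau>_def)
    have "(\<Sum>j\<in>J. S a j * (S'' j b / \<sigma>\<^sup>2)) =
        (\<Sum>j\<in>J. S a j * (S' j b / \<sigma>\<^sup>2)) - \<tau> * (\<Sum>j\<in>J. S a j * (S' j i / \<sigma>\<^sup>2))"
      unfolding S''_\<tau> by (simp add: sum_distrib_left sum_subtractf[symmetric] diff_divide_distrib algebra_simps)
    moreover have "S'' i b / \<sigma>\<^sup>2 = \<tau>"
    proof -
      have "S' i b = \<tau> * q" using q by (simp add: \<tau>_def)
      then show ?thesis using \<sigma> by (simp add: S''_\<tau> q_def field_simps)
    qed
    ultimately show ?thesis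
      unfolding sum.insert[OF insert.hyps] S_sum by (simp only: S''_\<tau>[of a]) (simp only: algebra_simps)
  qed
  ultimately show ?case
    using \<open>Z' > 0\<close> tg'' unfolding w_insert by blast
qed


section \<open>The posterior of a Gaussian process\<close>

lemma likelihood_pos: "likelihood \<sigma>n y z > 0" and likelihood_le_1: "likelihood \<sigma>n y z \<le> 1"
  by (simp_all add: likelihood_def)

text \<open>The squared norm splits over the coordinates, so the observations can be absorbed one at
  a time.\<close>

lemma likelihood_eq_prod:
  "likelihood \<sigma>n y z = (\<Prod>i\<in>UNIV. exp (- ((y $ i - z $ i)\<^sup>2 / (2 * \<sigma>n\<^sup>2))))"
proof -
  have "(norm (y - z))\<^sup>2 = (\<Sum>i\<in>UNIV. (y $ i - z $ i)\<^sup>2)"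
    unfolding power2_norm_eq_inner by (simp add: inner_vec_def power2_eq_square)
  then show ?thesis
    by (simp add: likelihood_def exp_sum[symmetric] sum_negf sum_divide_distrib[symmetric])
qed

lemma integral_likelihood_pos:
  assumes "prob_space M" and h: "\<And>x. h x \<in> borel_measurable M"
  shows "(\<integral>\<omega>. likelihood \<sigma>n y (eval_at h X \<omega>) \<partial>M) > 0"
proof -
  interpret prob_space M by fact
  note [measurable] = measurable_eval_at[of h M, OF h]
  have int: "integrable M (\<lambda>\<omega>. likelihood \<sigma>n y (eval_at h X \<omega>))"
    by (rule integrable_const_bound[of _ 1]) (auto simp: likelihood_pos less_imp_le likelihood_le_1)
  have "emeasure M (space M) \<noteq> 0" by (simp add: emeasure_space_1)
  then show ?thesis
    using integral_less_AE_space[of "\<lambda>_. 0" "\<lambda>\<omega>. likelihood \<sigma>n y (eval_at h X \<omega>)"] int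
    by (simp add: likelihood_pos)
qed

text \<open>Replaces the measure given by its values on Borel sets with a push-forward of a
  reweighted prior, for which the change-of-variables rules for integrals apply.\<close>

lemma posterior_eq_distr:
  fixes X :: "'x^'n" and y :: "real^'n" and \<sigma>n :: real
  assumes "prob_space M" and h: "\<And>x. h x \<in> borel_measurable M"
  defines "Z \<equiv> (\<integral>\<omega>. likelihood \<sigma>n y (eval_at h X \<omega>) \<partial>M)"
  shows "posterior M h X y \<sigma>n Xs =
    distr (density M (\<lambda>\<omega>. ennreal (likelihood \<sigma>n y (eval_at h X \<omega>) / Z))) borel (eval_at h Xs)"
    (is "_ = ?P")
proof (rule measure_eqI)
  interpret prob_space M by fact
  interpret post: prob_space "posterior M h X y \<sigma>n Xs" by (rule prob_space_posterior[OF assms(1) h])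
  note [measurable] = measurable_eval_at[of h M, OF h]
  have Z: "Z > 0" unfolding Z_def by (rule integral_likelihood_pos[OF assms(1) h])
  show "sets (posterior M h X y \<sigma>n Xs) = sets ?P" using sets_posterior[OF assms(1) h] by simp
  fix B assume "B \<in> sets (posterior M h X y \<sigma>n Xs)"
  then have B [measurable]: "B \<in> sets borel" by (simp only: sets_posterior[OF assms(1) h])
  define L where "L \<omega> = likelihood \<sigma>n y (eval_at h X \<omega>)" for \<omega>
  have L_meas [measurable]: "L \<in> borel_measurable M" unfolding L_def by measurable
  have L: "L \<omega> \<ge> 0" "L \<omega> \<le> 1" for \<omega> by (simp_all add: L_def likelihood_pos less_imp_le likelihood_le_1)
  have int: "integrable M (\<lambda>\<omega>. indicator B (eval_at h Xs \<omega>) * L \<omega> / Z)"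
    by (intro Bochner_Integration.integrable_divide integrable_const_bound[of _ 1])
       (use L in \<open>auto split: split_indicator\<close>)
  have "emeasure ?P B = (\<integral>\<^sup>+\<omega>. ennreal (L \<omega> / Z) * indicator (eval_at h Xs -` B \<inter> space M) \<omega> \<partial>M)"
    unfolding L_def[symmetric] by (subst emeasure_distr) (auto simp: emeasure_density)
  also have "\<dots> = (\<integral>\<^sup>+\<omega>. ennreal (indicator B (eval_at h Xs \<omega>) * L \<omega> / Z) \<partial>M)"
    by (intro nn_integral_cong) (auto split: split_indicator)
  also have "\<dots> = ennreal (\<integral>\<omega>. indicator B (eval_at h Xs \<omega>) * L \<omega> / Z \<partial>M)"
    using int Z L by (intro nn_integral_eq_integral AE_I2) auto
  also have "\<dots> = emeasure (posterior M h X y \<sigma>n Xs) B"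
    using measure_posterior[OF assms(1) h B, where X = X and y = y and \<sigma>n = \<sigma>n and Xs = Xs]
    by (simp add: post.emeasure_eq_measure L_def Z_def)
  finally show "emeasure (posterior M h X y \<sigma>n Xs) B = emeasure ?P B" ..
qed

text \<open>Extends Bayes' formula from indicators to functions. A general Banach-valued
  \<open>F\<close> covers both real test functions, for weak convergence, and complex characters,
  for identifying the limit.\<close>

lemma integral_posterior:
  fixes F :: "real^'s \<Rightarrow> 'c::{banach, second_countable_topology}"
  assumes "prob_space M" and h: "\<And>x. h x \<in> borel_measurable M" and F: "F \<in> borel_measurable borel"
  shows "(\<integral>z. F z \<partial>posterior M h X y \<sigma>n Xs) =
    (\<integral>\<omega>. likelihood \<sigma>n y (eval_at h X \<omega>) *\<^sub>R F (eval_at h Xs \<omega>) \<partial>M) /\<^sub>R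
      (\<integral>\<omega>. likelihood \<sigma>n y (eval_at h X \<omega>) \<partial>M)"
proof -
  interpret prob_space M by fact
  note [measurable] = measurable_eval_at[of h M, OF h] F
  define Z where "Z = (\<integral>\<omega>. likelihood \<sigma>n y (eval_at h X \<omega>) \<partial>M)"
  have Z: "Z > 0" unfolding Z_def by (rule integral_likelihood_pos[OF assms(1) h])
  have "(\<integral>z. F z \<partial>posterior M h X y \<sigma>n Xs) =
      (\<integral>\<omega>. F (eval_at h Xs \<omega>) \<partial>density M (\<lambda>\<omega>. ennreal (likelihood \<sigma>n y (eval_at h X \<omega>) / Z)))"
    unfolding posterior_eq_distr[OF assms(1) h] Z_def[symmetric] by (rule integral_distr) auto
  also have "\<dots> = (\<integral>\<omega>. (likelihood \<sigma>n y (eval_at h X \<omega>) / Z) *\<^sub>R F (eval_at h Xs \<omega>) \<partial>M)"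
    by (rule integral_density) (use Z in \<open>auto simp: likelihood_pos less_imp_le\<close>)
  also have "\<dots> = (\<integral>\<omega>. inverse Z *\<^sub>R (likelihood \<sigma>n y (eval_at h X \<omega>) *\<^sub>R F (eval_at h Xs \<omega>)) \<partial>M)"
    by (simp add: divide_inverse mult.commute)
  also have "\<dots> = inverse Z *\<^sub>R (\<integral>\<omega>. likelihood \<sigma>n y (eval_at h X \<omega>) *\<^sub>R F (eval_at h Xs \<omega>) \<partial>M)"
    by (rule integral_scaleR_right)
  finally show ?thesis by (simp add: Z_def)
qed

section \<open>The regularized kernel matrix and the explicit posterior\<close>

lemma matrix_inv_left:
  fixes A :: "real^'n^'n"
  assumes "invertible A"
  shows "matrix_inv A ** A = mat 1"
proof -
  have "\<exists>B. A ** B = mat 1 \<and> B ** A = mat 1" using assms by (simp add: invertible_def)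
  from someI_ex[OF this] show ?thesis by (simp add: matrix_inv_def)
qed

text \<open>The quadratic form of the sum at \<open>x\<close> is at least
  \<open>c * (x \<bullet> x)\<close>, so the kernel is trivial. This is how the noise variance makes
  up for a singular kernel matrix.\<close>

lemma invertible_psd_plus_scaled_identity:
  fixes K :: "real^'n^'n"
  assumes psd: "\<And>x. x \<bullet> (K *v x) \<ge> 0" and c: "c > 0"
  shows "invertible (K + c *\<^sub>R mat 1)"
proof -
  have "x = 0" if "(K + c *\<^sub>R mat 1) *v x = 0" for x
  proof -
    have "(K + c *\<^sub>R mat 1) *v x = K *v x + c *\<^sub>R x"
      by (simp add: matrix_vector_mult_add_rdistrib scaleR_matrix_vector_assoc[symmetric])
    then have "0 = x \<bullet> (K *v x) + c * (x \<bullet> x)"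
      using that by (metis inner_add_right inner_scaleR_right inner_zero_right)
    moreover have "c * (x \<bullet> x) \<ge> 0" using c by simp
    ultimately have "c * (x \<bullet> x) = 0" using psd[of x] by linarith
    then show "x = 0" using c by simp
  qed
  then show ?thesis using matrix_left_invertible_ker invertible_left_inverse by blast
qed

text \<open>The observations are processed jointly with the test points, so the prior is taken on the index
  type \<open>'s + 'n\<close>.\<close>

definition join_points :: "'x^'s \<Rightarrow> 'x^'n \<Rightarrow> 'x^('s + 'n)" where
  "join_points Xs X = (\<chi> i. case i of Inl a \<Rightarrow> Xs $ a | Inr b \<Rightarrow> X $ b)"

lemma join_points_simps [simp]: "join_points Xs X $ Inl a = Xs $ a" "join_points Xs X $ Inr b = X $ b"
  by (simp_all add: join_points_def)

lemma sum_UNIV_Plus: "(\<Sum>i\<in>UNIV. f i) = (\<Sum>a\<in>UNIV. f (Inl a)) + (\<Sum>b\<in>UNIV. f (Inr b))"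
  for f :: "'s::finite + 'n::finite \<Rightarrow> 'c::comm_monoid_add"
  using sum.Plus[of "UNIV :: 's set" "UNIV :: 'n set" f] by (simp add: comp_def)

text \<open>At the training indices the implicit equations are linear systems with matrix
  \<open>A\<close>, for the scaled residuals and for the scaled posterior cross-covariances. Solving
  them and inserting the solutions at the test indices yields the closed formulas.\<close>

theorem posterior_gaussian_process:
  fixes X :: "'x^'n" and Xs :: "'x^'s" and y :: "real^'n"
  assumes gp: "centered_gaussian_process M g k" and \<sigma>n: "\<sigma>n > 0"
  defines "A \<equiv> kernel_matrix k X X + \<sigma>n\<^sup>2 *\<^sub>R mat 1"
  shows "multivariate_normal_law (posterior M g X y \<sigma>n Xs)
      (kernel_matrix k Xs X ** matrix_inv A *v y)
      (kernel_matrix k Xs Xs - kernel_matrix k Xs X ** matrix_inv A ** kernel_matrix k X Xs)"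
proof -
  define P where "P = join_points Xs X"
  define S where "S = (\<lambda>i j. k (P $ i) (P $ j))"
  define G where "G = (\<lambda>i. g (P $ i))"
  have mn: "multivariate_normal M UNIV G (\<lambda>_. 0) S"
    unfolding S_def G_def by (rule centered_gaussian_process_finite[OF gp])
  have prob: "prob_space M" using mn by (simp add: multivariate_normal_def)
  interpret prob_space M by (rule prob)
  \<comment> \<open>A process is given through finite vectors only; a list with one point yields
    measurability of a single value.\<close>
  have g: "g x \<in> borel_measurable M" for x
    using centered_gaussian_process_finite[OF gp, of "\<chi> i :: unit. x"] by (simp add: multivariate_normal_def)
  have [measurable]: "G i \<in> borel_measurable M" for i by (simp add: G_def g)
  have sym: "S i j = S j i" for i j by (rule multivariate_normal_moments(6)[OF mn])
  have tg: "tilted_gaussian M (\<lambda>_. 1) G (\<lambda>_. 0) S 1"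
    unfolding tilted_gaussian_def using sym multivariate_normal_char[OF mn] by simp
  define y' where "y' = (\<lambda>i :: 's + 'n. case i of Inl _ \<Rightarrow> 0 | Inr b \<Rightarrow> y $ b)"
  have "finite (range (Inr :: 'n \<Rightarrow> 's + 'n))" by simp
  from tilted_gaussian_observations[OF prob _ tg \<sigma>n this, of y']
  obtain m' S' Z where Z: "Z > 0"
    and tg': "tilted_gaussian M (\<lambda>\<omega>. \<Prod>j\<in>range Inr. exp (- ((y' j - G j \<omega>)\<^sup>2 / (2 * \<sigma>n\<^sup>2)))) G m' S' Z"
    and m': "\<And>a. m' a = (\<Sum>j\<in>range Inr. S a j * ((y' j - m' j) / \<sigma>n\<^sup>2))"
    and S': "\<And>a b. S' a b = S a b - (\<Sum>j\<in>range Inr. S a j * (S' j b / \<sigma>n\<^sup>2))"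
    by auto
  have range_sum: "(\<Sum>j\<in>range (Inr :: 'n \<Rightarrow> 's + 'n). f j) = (\<Sum>b\<in>UNIV. f (Inr b))" for f :: "_ \<Rightarrow> real"
    by (simp add: sum.reindex)
  have "(\<lambda>\<omega>. \<Prod>j\<in>range Inr. exp (- ((y' j - G j \<omega>)\<^sup>2 / (2 * \<sigma>n\<^sup>2)))) = (\<lambda>\<omega>. likelihood \<sigma>n y (eval_at g X \<omega>))"
    by (simp add: prod.reindex likelihood_eq_prod y'_def G_def P_def eval_at_def)
  note tg' = tg'[unfolded this]
  have total: "(\<integral>\<omega>. likelihood \<sigma>n y (eval_at g X \<omega>) \<partial>M) = Z" by (rule tilted_gaussian_total[OF tg'])
  let ?post = "posterior M g X y \<sigma>n Xs"
  have post: "prob_space ?post" "sets ?post = sets borel"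
    by (rule prob_space_posterior[OF prob g], rule sets_posterior[OF prob g])
  have law: "multivariate_normal ?post UNIV (\<lambda>i z. z $ i) (\<lambda>i. m' (Inl i)) (\<lambda>i j. S' (Inl i) (Inl j))"
  proof (rule multivariate_normalI_char[OF post(1)])
    show "(\<lambda>z. z $ i) \<in> borel_measurable ?post" for i
      unfolding measurable_cong_sets[OF post(2) refl] by (intro borel_measurable_continuous_onI continuous_intros)
    show "S' (Inl i) (Inl j) = S' (Inl j) (Inl i)" for i j using tg' by (simp add: tilted_gaussian_def)
    fix a :: "'s \<Rightarrow> real"
    \<comment> \<open>Padding with zeros at the training indices turns the transform of the test
      marginal into one of the joint vector.\<close>
    define a' where "a' = (\<lambda>i :: 's + 'n. case i of Inl s \<Rightarrow> a s | Inr _ \<Rightarrow> 0)"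
    have [measurable]: "(\<lambda>z::real^'s. cis (\<Sum>i\<in>UNIV. a i * z $ i)) \<in> borel_measurable borel"
      unfolding cis_conv_exp by (intro borel_measurable_continuous_onI continuous_intros)
    have "(\<integral>z. cis (\<Sum>i\<in>UNIV. a i * z $ i) \<partial>?post) =
        (\<integral>\<omega>. likelihood \<sigma>n y (eval_at g X \<omega>) *\<^sub>R cis (\<Sum>i\<in>UNIV. a i * eval_at g Xs \<omega> $ i) \<partial>M) /\<^sub>R Z"
      unfolding total[symmetric] by (rule integral_posterior[OF prob g]) simp
    also have "(\<integral>\<omega>. likelihood \<sigma>n y (eval_at g X \<omega>) *\<^sub>R cis (\<Sum>i\<in>UNIV. a i * eval_at g Xs \<omega> $ i) \<partial>M) =
        (\<integral>\<omega>. complex_of_real (likelihood \<sigma>n y (eval_at g X \<omega>)) * cis (\<Sum>j\<in>UNIV. a' j * G j \<omega>) \<partial>M)"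
      by (simp add: sum_UNIV_Plus a'_def eval_at_def G_def P_def scaleR_conv_of_real)
    also have "\<dots> = complex_of_real Z * (cis (\<Sum>j\<in>UNIV. a' j * m' j) *
        complex_of_real (exp (- ((\<Sum>j\<in>UNIV. \<Sum>l\<in>UNIV. a' j * a' l * S' j l) / 2))))"
      using tg' unfolding tilted_gaussian_def by blast
    also have "(\<Sum>j\<in>UNIV. a' j * m' j) = (\<Sum>i\<in>UNIV. a i * m' (Inl i))"
      by (simp add: sum_UNIV_Plus a'_def)
    also have "(\<Sum>j\<in>UNIV. \<Sum>l\<in>UNIV. a' j * a' l * S' j l) = (\<Sum>i\<in>UNIV. \<Sum>j\<in>UNIV. a i * a j * S' (Inl i) (Inl j))"
      by (simp add: sum_UNIV_Plus a'_def)
    finally show "(\<integral>z. cis (\<Sum>i\<in>UNIV. a i * z $ i) \<partial>?post) = cis (\<Sum>i\<in>UNIV. a i * m' (Inl i)) *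
        complex_of_real (exp (- ((\<Sum>i\<in>UNIV. \<Sum>j\<in>UNIV. a i * a j * S' (Inl i) (Inl j)) / 2)))"
      using Z by (simp add: scaleR_conv_of_real)
  qed

  have "x \<bullet> (kernel_matrix k X X *v x) \<ge> 0" for x
  proof -
    \<comment> \<open>Supported on the training indices, so the form of \<open>K(X,X)\<close> is a
      variance of the joint prior vector.\<close>
    define a where "a = (\<lambda>i :: 's + 'n. case i of Inl _ \<Rightarrow> 0 | Inr b \<Rightarrow> x $ b)"
    have "x \<bullet> (kernel_matrix k X X *v x) = (\<Sum>i\<in>UNIV. \<Sum>j\<in>UNIV. a i * a j * S i j)"
      by (simp add: sum_UNIV_Plus a_def S_def P_def inner_vec_def matrix_vector_mult_def kernel_matrix_def
          sum_distrib_left mult_ac)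
    then show ?thesis using multivariate_normal_linear(1)[OF mn, of a] by simp
  qed
  then have inv: "invertible A" unfolding A_def using \<sigma>n by (intro invertible_psd_plus_scaled_identity) auto
  have A_entry: "A $ a $ b = S (Inr a) (Inr b) + (if a = b then \<sigma>n\<^sup>2 else 0)" for a b
    by (simp add: A_def kernel_matrix_def mat_def S_def P_def)
  \<comment> \<open>The scaled residuals are the weights of the posterior mean in terms of kernel
    columns; the mean equations at training indices say \<open>A *v \<beta> = y\<close>.\<close>
  define \<beta> :: "real^'n" where "\<beta> = (\<chi> b. (y $ b - m' (Inr b)) / \<sigma>n\<^sup>2)"
  have m'_\<beta>: "m' i = (\<Sum>b\<in>UNIV. S i (Inr b) * \<beta> $ b)" for i
    using m'[of i] unfolding range_sum by (simp add: \<beta>_def y'_def)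
  have "A *v \<beta> = y"
  proof (rule vec_eq_iff[THEN iffD2], rule allI)
    fix a
    have "(A *v \<beta>) $ a = (\<Sum>b\<in>UNIV. S (Inr a) (Inr b) * \<beta> $ b) + \<sigma>n\<^sup>2 * \<beta> $ a"
      by (simp add: matrix_vector_mult_def A_entry distrib_right sum.distrib mult_delta_left)
    also have "\<dots> = y $ a" unfolding m'_\<beta>[symmetric] using \<sigma>n by (simp add: \<beta>_def)
    finally show "(A *v \<beta>) $ a = y $ a" .
  qed
  then have \<beta>: "matrix_inv A *v y = \<beta>"
    using matrix_inv_left[OF inv] by (metis matrix_vector_mul_assoc matrix_vector_mul_lid)
  have mean: "(kernel_matrix k Xs X ** matrix_inv A *v y) $ i = m' (Inl i)" for i
    unfolding matrix_vector_mul_assoc[symmetric] \<beta> m'_\<beta>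
    by (simp add: matrix_vector_mult_def kernel_matrix_def S_def P_def)
  \<comment> \<open>The covariance analogue of \<open>\<beta>\<close>: at training rows the
    equations read \<open>A ** B = kernel_matrix k X Xs\<close>.\<close>
  define B :: "real^'s^'n" where "B = (\<chi> b s. S' (Inr b) (Inl s) / \<sigma>n\<^sup>2)"
  have S'_B: "S' i (Inl s) = S i (Inl s) - (\<Sum>b\<in>UNIV. S i (Inr b) * B $ b $ s)" for i s
    using S'[of i "Inl s"] unfolding range_sum by (simp add: B_def)
  have "A ** B = kernel_matrix k X Xs"
  proof (simp only: vec_eq_iff, intro allI)
    fix a s
    have "(A ** B) $ a $ s = (\<Sum>b\<in>UNIV. S (Inr a) (Inr b) * B $ b $ s) + \<sigma>n\<^sup>2 * B $ a $ s"
      by (simp add: matrix_matrix_mult_def A_entry distrib_right sum.distrib mult_delta_left)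
    also have "\<sigma>n\<^sup>2 * B $ a $ s = S' (Inr a) (Inl s)" using \<sigma>n by (simp add: B_def)
    finally show "(A ** B) $ a $ s = kernel_matrix k X Xs $ a $ s"
      unfolding S'_B by (simp add: kernel_matrix_def S_def P_def)
  qed
  then have B: "matrix_inv A ** kernel_matrix k X Xs = B"
    using matrix_inv_left[OF inv] by (metis matrix_mul_assoc matrix_mul_lid)
  have cov: "(kernel_matrix k Xs Xs - kernel_matrix k Xs X ** matrix_inv A ** kernel_matrix k X Xs) $ i $ j
      = S' (Inl i) (Inl j)" for i j
    unfolding matrix_mul_assoc[symmetric] B S'_B
    by (simp add: matrix_matrix_mult_def kernel_matrix_def S_def P_def)
  show ?thesis unfolding multivariate_normal_law_def mean cov using law post(2) by simp
qed


section \<open>Product features of i.i.d. normal weights\<close>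

text \<open>Injectivity makes the singletons \<open>{f i}\<close> disjoint blocks of indices; each
  block is then projected to its only component.\<close>

lemma (in prob_space) indep_vars_reindex:
  assumes ind: "indep_vars M' X (f ` I)" and inj: "inj_on f I"
  shows "indep_vars (\<lambda>i. M' (f i)) (\<lambda>i. X (f i)) I"
proof -
  have "indep_vars (\<lambda>i. PiM {f i} M') (\<lambda>i \<omega>. restrict (\<lambda>k. X k \<omega>) {f i}) I"
    using inj by (intro indep_vars_restrict[OF ind]) (auto simp: disjoint_family_on_def inj_on_def)
  then have "indep_vars (\<lambda>i. M' (f i)) (\<lambda>i \<omega>. (restrict (\<lambda>k. X k \<omega>) {f i}) (f i)) I"
    by (rule indep_vars_compose2) (rule measurable_component_singleton, simp)
  then show ?thesis by simp
qed

lemma (in prob_space) indep_vars_uncorrelated: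
  fixes X :: "'i \<Rightarrow> 'a \<Rightarrow> real"
  assumes "indep_vars (\<lambda>_. borel) X I" "i \<in> I" "j \<in> I" "i \<noteq> j" "integrable M (X i)" "integrable M (X j)"
  shows "integrable M (\<lambda>\<omega>. X i \<omega> * X j \<omega>)" "expectation (\<lambda>\<omega>. X i \<omega> * X j \<omega>) = expectation (X i) * expectation (X j)"
proof -
  have ind: "indep_vars (\<lambda>_. borel) X {i, j}" using assms by (intro indep_vars_subset[OF assms(1)]) auto
  have "\<And>k. k \<in> {i, j} \<Longrightarrow> integrable M (X k)" using assms by auto
  from indep_vars_lebesgue_integral[OF _ ind this] indep_vars_integrable[OF _ ind this] assms(4)
  show "integrable M (\<lambda>\<omega>. X i \<omega> * X j \<omega>)" "expectation (\<lambda>\<omega>. X i \<omega> * X j \<omega>) = expectation (X i) * expectation (X j)"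
    by simp_all
qed

text \<open>Off-diagonal products have mean 0, and the \<open>n\<close> diagonal terms
  \<open>V\<close> cancel the factor \<open>1 / n\<close>. For \<open>n = 0\<close> the sum is 0,
  hence the restriction in the second claim.\<close>

lemma (in prob_space) iid_normalized_sum_second_moment:
  fixes X :: "nat \<Rightarrow> 'a \<Rightarrow> real"
  assumes ind: "indep_vars (\<lambda>_. borel) X UNIV"
    and sq: "\<And>n. integrable M (\<lambda>\<omega>. (X n \<omega>)\<^sup>2)" and mean: "\<And>n. expectation (X n) = 0"
    and var: "\<And>n. expectation (\<lambda>\<omega>. (X n \<omega>)\<^sup>2) = V"
  shows "integrable M (\<lambda>\<omega>. (1 / sqrt (real n) * (\<Sum>i<n. X i \<omega>))\<^sup>2)"
    and "n > 0 \<Longrightarrow> expectation (\<lambda>\<omega>. (1 / sqrt (real n) * (\<Sum>i<n. X i \<omega>))\<^sup>2) = V"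
proof -
  have [measurable]: "X n \<in> borel_measurable M" for n using ind by (simp add: indep_vars_def)
  have int: "integrable M (X n)" for n by (rule square_integrable_imp_integrable[OF _ sq]) simp
  have prod: "integrable M (\<lambda>\<omega>. X i \<omega> * X j \<omega>)"
    "expectation (\<lambda>\<omega>. X i \<omega> * X j \<omega>) = (if i = j then V else 0)" for i j
    using indep_vars_uncorrelated[OF ind, of i j] int mean sq[of i] var[of i]
    by (cases "i = j"; simp add: power2_eq_square)+
  have eq: "(1 / sqrt (real n) * (\<Sum>i<n. X i \<omega>))\<^sup>2 = 1 / real n * (\<Sum>i<n. \<Sum>j<n. X i \<omega> * X j \<omega>)" for \<omega>
    by (simp add: power_mult_distrib power_divide power2_eq_square[of "sum _ _"] sum_product)
  show "integrable M (\<lambda>\<omega>. (1 / sqrt (real n) * (\<Sum>i<n. X i \<omega>))\<^sup>2)"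
    unfolding eq by (intro integrable_mult_right Bochner_Integration.integrable_sum prod)
  assume n: "n > 0"
  have "expectation (\<lambda>\<omega>. (1 / sqrt (real n) * (\<Sum>i<n. X i \<omega>))\<^sup>2) = 1 / real n * (\<Sum>i<n. \<Sum>j<n. if i = j then V else 0)"
    unfolding eq using prod by simp
  also have "\<dots> = V" using n by simp
  finally show "expectation (\<lambda>\<omega>. (1 / sqrt (real n) * (\<Sum>i<n. X i \<omega>))\<^sup>2) = V" .
qed

text \<open>Unlike the central limit theorem of the library, this form allows the degenerate case \<open>V = 0\<close>.\<close>

lemma (in prob_space) iid_normalized_sum_characteristic:
  fixes X :: "nat \<Rightarrow> 'a \<Rightarrow> real"
  assumes ind: "indep_vars (\<lambda>_. borel) X UNIV"
    and distr: "\<And>n. distr M borel (X n) = \<mu>"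
    and sq: "\<And>n. integrable M (\<lambda>\<omega>. (X n \<omega>)\<^sup>2)" and mean: "\<And>n. expectation (X n) = 0"
    and var: "\<And>n. expectation (\<lambda>\<omega>. (X n \<omega>)\<^sup>2) = V"
  shows "(\<lambda>n. \<integral>\<omega>. cis (1 / sqrt (real n) * (\<Sum>i<n. X i \<omega>)) \<partial>M) \<longlonglongrightarrow> complex_of_real (exp (- (V / 2)))"
proof (cases "V = 0")
  case True
  have [measurable]: "X n \<in> borel_measurable M" for n using ind by (simp add: indep_vars_def)
  have "(\<integral>\<omega>. cis (1 / sqrt (real n) * (\<Sum>i<n. X i \<omega>)) \<partial>M) = 1" for n
  proof (cases "n = 0")
    case False
    \<comment> \<open>The normalized sum has second moment \<open>V = 0\<close>, so it vanishes
      almost surely.\<close>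
    have "AE \<omega> in M. (1 / sqrt (real n) * (\<Sum>i<n. X i \<omega>))\<^sup>2 = 0"
      using integral_nonneg_eq_0_iff_AE[of M "\<lambda>\<omega>. (1 / sqrt (real n) * (\<Sum>i<n. X i \<omega>))\<^sup>2"]
        iid_normalized_sum_second_moment[OF ind sq mean var, of n] False True by simp
    then have "AE \<omega> in M. cis (1 / sqrt (real n) * (\<Sum>i<n. X i \<omega>)) = 1" by eventually_elim auto
    then have "(\<integral>\<omega>. cis (1 / sqrt (real n) * (\<Sum>i<n. X i \<omega>)) \<partial>M) = (\<integral>\<omega>. 1 \<partial>M)"
      by (intro integral_cong_AE) (auto simp: cis_conv_exp)
    then show ?thesis by (simp add: prob_space)
  qed (simp add: prob_space)
  then show ?thesis using True by simp
next
  case False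
  have [measurable]: "X n \<in> borel_measurable M" for n using ind by (simp add: indep_vars_def)
  have "V \<ge> 0" unfolding var[of 0, symmetric] by simp
  then have V: "V > 0" using False by simp
  have "weak_conv_m (\<lambda>n. distr M borel (\<lambda>\<omega>. (\<Sum>i<n. X i \<omega>) / sqrt (real n * (sqrt V)\<^sup>2))) std_normal_distribution"
    by (rule central_limit_theorem_zero_mean[OF ind mean _ sq _ distr]) (use V mean var in auto)
  \<comment> \<open>The central limit theorem divides by the standard deviation; evaluating the
    characteristic functions at \<open>sqrt V\<close> undoes this.\<close>
  then have "(\<lambda>n. char (distr M borel (\<lambda>\<omega>. (\<Sum>i<n. X i \<omega>) / sqrt (real n * (sqrt V)\<^sup>2))) (sqrt V))
      \<longlonglongrightarrow> char std_normal_distribution (sqrt V)"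
    by (intro levy_continuity1 real_dist_normal_dist real_distribution_distr) simp_all
  moreover have "char (distr M borel (\<lambda>\<omega>. (\<Sum>i<n. X i \<omega>) / sqrt (real n * (sqrt V)\<^sup>2))) (sqrt V) =
      (\<integral>\<omega>. cis (1 / sqrt (real n) * (\<Sum>i<n. X i \<omega>)) \<partial>M)" for n
  proof -
    have "char (distr M borel (\<lambda>\<omega>. (\<Sum>i<n. X i \<omega>) / sqrt (real n * (sqrt V)\<^sup>2))) (sqrt V) =
        (\<integral>\<omega>. cis (sqrt V * ((\<Sum>i<n. X i \<omega>) / sqrt (real n * (sqrt V)\<^sup>2))) \<partial>M)"
      unfolding char_def cis_conv_exp[symmetric] by (subst integral_distr) (auto simp: cis_conv_exp)
    then show ?thesis using V by (simp add: real_sqrt_mult)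
  qed
  ultimately show ?thesis using V by (simp add: char_std_normal_distribution)
qed

section \<open>Random features: independence, moments and laws\<close>

locale iid_normal_weights = prob_space \<Omega> for \<Omega> :: "'a measure" +
  fixes J :: "'d::finite \<Rightarrow> nat" and w :: "'d \<Rightarrow> nat \<Rightarrow> nat \<Rightarrow> 'a \<Rightarrow> real" and \<sigma>w :: real
    and \<phi> :: "'d \<Rightarrow> nat \<Rightarrow> real \<Rightarrow> real"
  assumes J: "\<And>d. J d \<ge> 1" and \<sigma>w: "\<sigma>w > 0"
    and w_normal: "\<And>d j m. j \<in> {1..J d} \<Longrightarrow> m \<ge> 1 \<Longrightarrow>
          distributed \<Omega> lborel (w d j m) (\<lambda>t. ennreal (normal_density 0 \<sigma>w t))"
    and w_indep: "indep_vars (\<lambda>_. borel) (\<lambda>(d, j, m). w d j m) {(d, j, m). j \<in> {1..J d} \<and> m \<ge> 1}"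
begin

definition indices :: "('d \<times> nat) set" where
  "indices = (SIGMA d : UNIV. {1..J d})"

text \<open>Bundles all weights of the \<open>m\<close>-th summand into one random element of a
  product space, so that the summands become one measurable function of i.i.d. vectors; the
  restriction places the value in that space.\<close>

definition weights :: "nat \<Rightarrow> 'a \<Rightarrow> 'd \<times> nat \<Rightarrow> real" where
  "weights m \<omega> = (\<lambda>(d, j)\<in>indices. w d j m \<omega>)"

definition factor :: "real^'d \<Rightarrow> 'd \<Rightarrow> ('d \<times> nat \<Rightarrow> real) \<Rightarrow> real" where
  "factor x d v = (\<Sum>j=1..J d. \<phi> d j (x $ d) * v (d, j))"

definition feature :: "real^'d \<Rightarrow> ('d \<times> nat \<Rightarrow> real) \<Rightarrow> real" where
  "feature x v = (\<Prod>d\<in>UNIV. factor x d v)"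

lemma ybar_eq_feature: "ybar J \<phi> w M x \<omega> = 1 / sqrt (real M) * (\<Sum>m<M. feature x (weights (Suc m) \<omega>))"
proof -
  have "(\<Prod>d\<in>UNIV. \<Sum>j=1..J d. \<phi> d j (x $ d) * w d j m \<omega>) = feature x (weights m \<omega>)" for m
    unfolding feature_def factor_def weights_def indices_def by (intro prod.cong sum.cong) auto
  then show ?thesis
    unfolding ybar_def by (simp add: sum.atLeast1_atMost_eq)
qed

lemma measurable_factor: "(\<And>j. j \<in> {1..J d} \<Longrightarrow> (d, j) \<in> A) \<Longrightarrow> factor x d \<in> borel_measurable (PiM A (\<lambda>_. borel))"
  unfolding factor_def
  by (intro borel_measurable_sum borel_measurable_times borel_measurable_const measurable_component_singleton) auto

lemma measurable_feature: "feature x \<in> borel_measurable (PiM indices (\<lambda>_. borel))"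
  unfolding feature_def by (intro borel_measurable_prod measurable_factor) (auto simp: indices_def)

lemma w_law: "j \<in> {1..J d} \<Longrightarrow> m \<ge> 1 \<Longrightarrow> distr \<Omega> borel (w d j m) = normal_law 0 (\<sigma>w\<^sup>2)"
  using w_normal[of j d m] \<sigma>w unfolding distributed_def normal_law_def by (simp cong: distr_cong)

lemma w_measurable: "j \<in> {1..J d} \<Longrightarrow> m \<ge> 1 \<Longrightarrow> w d j m \<in> borel_measurable \<Omega>"
  using w_normal[of j d m] unfolding distributed_def by simp

lemma
  assumes j: "j \<in> {1..J d}" and m: "m \<ge> 1"
  shows w_integrable: "integrable \<Omega> (w d j m)"
    and w_mean: "expectation (w d j m) = 0"
  using normal_rv_integrable[OF w_measurable w_law, OF j m j m] normal_rv_mean[OF w_measurable w_law, OF j m j m] by auto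

lemma
  assumes j: "j \<in> {1..J d}" and j': "j' \<in> {1..J d}" and m: "m \<ge> 1"
  shows w_prod_integrable: "integrable \<Omega> (\<lambda>\<omega>. w d j m \<omega> * w d j' m \<omega>)"
    and w_prod_mean: "expectation (\<lambda>\<omega>. w d j m \<omega> * w d j' m \<omega>) = (if j = j' then \<sigma>w\<^sup>2 else 0)"
  using indep_vars_uncorrelated[OF w_indep, of "(d, j, m)" "(d, j', m)"] w_integrable[OF j m] w_integrable[OF j' m]
    normal_rv_integrable_square[OF w_measurable w_law, OF j m j m]
    normal_rv_variance[OF w_measurable w_law, OF j m j m] w_mean[OF j m] j j' m
  by (cases "j = j'"; simp add: power2_eq_square)+

lemma factor_weights: "factor x d (weights m \<omega>) = (\<Sum>j=1..J d. \<phi> d j (x $ d) * w d j m \<omega>)"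
  by (simp add: factor_def weights_def indices_def)

lemma
  assumes m: "m \<ge> 1"
  shows factor_integrable: "integrable \<Omega> (\<lambda>\<omega>. factor x d (weights m \<omega>))"
    and factor_mean: "expectation (\<lambda>\<omega>. factor x d (weights m \<omega>)) = 0"
    and factor_prod_integrable: "integrable \<Omega> (\<lambda>\<omega>. factor x d (weights m \<omega>) * factor x' d (weights m \<omega>))"
    and factor_prod_mean: "expectation (\<lambda>\<omega>. factor x d (weights m \<omega>) * factor x' d (weights m \<omega>)) =
      \<sigma>w\<^sup>2 * (\<Sum>j=1..J d. \<phi> d j (x $ d) * \<phi> d j (x' $ d))"
proof -
  show "integrable \<Omega> (\<lambda>\<omega>. factor x d (weights m \<omega>))"
    unfolding factor_weights using m by (intro Bochner_Integration.integrable_sum integrable_mult_right w_integrable)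
  show "expectation (\<lambda>\<omega>. factor x d (weights m \<omega>)) = 0"
    unfolding factor_weights using m by (subst Bochner_Integration.integral_sum) (auto simp: w_integrable w_mean)
  have eq: "factor x d (weights m \<omega>) * factor x' d (weights m \<omega>) =
      (\<Sum>j=1..J d. \<Sum>j'=1..J d. \<phi> d j (x $ d) * \<phi> d j' (x' $ d) * (w d j m \<omega> * w d j' m \<omega>))" for \<omega>
    unfolding factor_weights sum_product by (simp add: mult_ac)
  show "integrable \<Omega> (\<lambda>\<omega>. factor x d (weights m \<omega>) * factor x' d (weights m \<omega>))"
    unfolding eq using m by (intro Bochner_Integration.integrable_sum integrable_mult_right w_prod_integrable)
  have "expectation (\<lambda>\<omega>. factor x d (weights m \<omega>) * factor x' d (weights m \<omega>)) =
      (\<Sum>j=1..J d. \<Sum>j'=1..J d. \<phi> d j (x $ d) * \<phi> d j' (x' $ d) * (if j = j' then \<sigma>w\<^sup>2 else 0))"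
    unfolding eq using m
    by (subst Bochner_Integration.integral_sum,
        intro Bochner_Integration.integrable_sum integrable_mult_right w_prod_integrable; simp?)
       (intro sum.cong refl, subst Bochner_Integration.integral_sum, auto simp: w_prod_integrable w_prod_mean)
  also have "\<dots> = \<sigma>w\<^sup>2 * (\<Sum>j=1..J d. \<phi> d j (x $ d) * \<phi> d j (x' $ d))"
    by (simp add: sum_distrib_left mult_delta_right mult_ac)
  finally show "expectation (\<lambda>\<omega>. factor x d (weights m \<omega>) * factor x' d (weights m \<omega>)) =
      \<sigma>w\<^sup>2 * (\<Sum>j=1..J d. \<phi> d j (x $ d) * \<phi> d j (x' $ d))" .
qed

lemma w_indep_slice:
  assumes m: "m \<ge> 1"
  shows "indep_vars (\<lambda>_. borel) (\<lambda>p \<omega>. w (fst p) (snd p) m \<omega>) indices"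
proof -
  have "indep_vars (\<lambda>_. borel) (\<lambda>(d, j, m). w d j m) ((\<lambda>p. (fst p, snd p, m)) ` indices)"
    by (rule indep_vars_subset[OF w_indep]) (use m in \<open>auto simp: indices_def\<close>)
  moreover have "inj_on (\<lambda>p. (fst p, snd p, m)) indices" by (auto simp: inj_on_def prod_eq_iff)
  ultimately show ?thesis using indep_vars_reindex by fastforce
qed

text \<open>The blocks of weights belonging to different coordinates \<open>d\<close> are disjoint.
  This independence is what turns moments of a product feature into products over
  \<open>d\<close>.\<close>

lemma indep_coordinates:
  assumes m: "m \<ge> 1"
  shows "indep_vars (\<lambda>d. PiM ({d} \<times> {1..J d}) (\<lambda>_. borel)) (\<lambda>d \<omega>. restrict (weights m \<omega>) ({d} \<times> {1..J d})) UNIV"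
proof -
  have "indep_vars (\<lambda>d. PiM ({d} \<times> {1..J d}) (\<lambda>_. borel))
      (\<lambda>d \<omega>. restrict (\<lambda>p. w (fst p) (snd p) m \<omega>) ({d} \<times> {1..J d})) UNIV"
    by (rule indep_vars_restrict[OF w_indep_slice[OF m]]) (auto simp: indices_def disjoint_family_on_def)
  moreover have "restrict (\<lambda>p. w (fst p) (snd p) m \<omega>) ({d} \<times> {1..J d}) = restrict (weights m \<omega>) ({d} \<times> {1..J d})" for d \<omega>
    by (auto simp: weights_def indices_def fun_eq_iff)
  ultimately show ?thesis by simp
qed

lemma factor_restrict: "factor x d (restrict v ({d} \<times> {1..J d})) = factor x d v"
  by (simp add: factor_def)

text \<open>The factors of one feature, and the coordinatewise products of two, are independent over
  \<open>d\<close>, so expectations multiply. The mean is a product of zeros over the nonempty type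
  \<open>'d\<close>; the mixed moment is the defining product of the kernel.\<close>

lemma
  assumes m: "m \<ge> 1"
  shows feature_integrable: "integrable \<Omega> (\<lambda>\<omega>. feature x (weights m \<omega>))"
    and feature_mean: "expectation (\<lambda>\<omega>. feature x (weights m \<omega>)) = 0"
    and feature_prod_integrable: "integrable \<Omega> (\<lambda>\<omega>. feature x (weights m \<omega>) * feature x' (weights m \<omega>))"
    and feature_prod_mean: "expectation (\<lambda>\<omega>. feature x (weights m \<omega>) * feature x' (weights m \<omega>)) = kernel J \<phi> \<sigma>w x x'"
proof -
  have "indep_vars (\<lambda>_. borel) (\<lambda>d \<omega>. factor x d (restrict (weights m \<omega>) ({d} \<times> {1..J d}))) UNIV"
    by (rule indep_vars_compose2[OF indep_coordinates[OF m]]) (rule measurable_factor, auto)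
  then have ind1: "indep_vars (\<lambda>_. borel) (\<lambda>d \<omega>. factor x d (weights m \<omega>)) UNIV" by (simp only: factor_restrict)
  have "indep_vars (\<lambda>_. borel) (\<lambda>d \<omega>. factor x d (restrict (weights m \<omega>) ({d} \<times> {1..J d})) *
      factor x' d (restrict (weights m \<omega>) ({d} \<times> {1..J d}))) UNIV"
    by (rule indep_vars_compose2[OF indep_coordinates[OF m]]) (intro borel_measurable_times measurable_factor, auto)
  then have ind2: "indep_vars (\<lambda>_. borel) (\<lambda>d \<omega>. factor x d (weights m \<omega>) * factor x' d (weights m \<omega>)) UNIV"
    by (simp only: factor_restrict)
  note 1 = indep_vars_lebesgue_integral[OF _ ind1] indep_vars_integrable[OF _ ind1]
  note 2 = indep_vars_lebesgue_integral[OF _ ind2] indep_vars_integrable[OF _ ind2]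
  show "integrable \<Omega> (\<lambda>\<omega>. feature x (weights m \<omega>))" "expectation (\<lambda>\<omega>. feature x (weights m \<omega>)) = 0"
    unfolding feature_def using 1 m by (simp_all add: factor_integrable factor_mean)
  show "integrable \<Omega> (\<lambda>\<omega>. feature x (weights m \<omega>) * feature x' (weights m \<omega>))"
    "expectation (\<lambda>\<omega>. feature x (weights m \<omega>) * feature x' (weights m \<omega>)) = kernel J \<phi> \<sigma>w x x'"
    unfolding feature_def prod.distrib[symmetric] kernel_def
    using 2 m by (simp_all add: factor_prod_integrable factor_prod_mean)
qed

lemma weights_measurable: "m \<ge> 1 \<Longrightarrow> weights m \<in> measurable \<Omega> (PiM indices (\<lambda>_. borel))"
  unfolding weights_def[abs_def] by (intro measurable_restrict) (auto simp: indices_def intro: w_measurable)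

text \<open>Index triples with different third component form disjoint blocks \<open>K n\<close>; a
  measurable relabelling then moves every block to the common index set \<open>indices\<close>, as
  equality of laws demands.\<close>

lemma weights_indep: "indep_vars (\<lambda>_. PiM indices (\<lambda>_. borel)) (\<lambda>n. weights (Suc n)) UNIV"
proof -
  define K where "K n = (\<lambda>(d, j). (d, j, Suc n)) ` indices" for n
  have "indep_vars (\<lambda>n. PiM (K n) (\<lambda>_. borel)) (\<lambda>n \<omega>. restrict (\<lambda>i. (\<lambda>(d, j, m). w d j m) i \<omega>) (K n)) UNIV"
    by (rule indep_vars_restrict[OF w_indep]) (auto simp: K_def indices_def disjoint_family_on_def)
  then have "indep_vars (\<lambda>_. PiM indices (\<lambda>_. borel))
      (\<lambda>n \<omega>. (\<lambda>v. \<lambda>p\<in>indices. v (fst p, snd p, Suc n)) (restrict (\<lambda>i. (\<lambda>(d, j, m). w d j m) i \<omega>) (K n))) UNIV"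
    by (rule indep_vars_compose2)
       (intro measurable_restrict measurable_component_singleton, auto simp: K_def)
  moreover have "(\<lambda>v. \<lambda>p\<in>indices. v (fst p, snd p, Suc n)) (restrict (\<lambda>i. (\<lambda>(d, j, m). w d j m) i \<omega>) (K n)) = weights (Suc n) \<omega>" for n \<omega>
    by (auto simp: weights_def K_def fun_eq_iff image_iff split: prod.splits)
  ultimately show ?thesis by simp
qed

text \<open>By independence the joint law is the product of the marginals, and these do not depend
  on \<open>m\<close>.\<close>

lemma weights_distr:
  assumes m: "m \<ge> 1"
  shows "distr \<Omega> (PiM indices (\<lambda>_. borel)) (weights m) = PiM indices (\<lambda>_. normal_law 0 (\<sigma>w\<^sup>2))"
proof -
  \<comment> \<open>The product characterization of independence asks for a nonempty index set,
    supplied by \<open>J d \<ge> 1\<close>.\<close>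
  have "(undefined, 1) \<in> indices" using J by (simp add: indices_def)
  then have ne: "indices \<noteq> {}" by blast
  have "distr \<Omega> (PiM indices (\<lambda>_. borel)) (\<lambda>\<omega>. \<lambda>p\<in>indices. w (fst p) (snd p) m \<omega>) =
      PiM indices (\<lambda>p. distr \<Omega> borel (\<lambda>\<omega>. w (fst p) (snd p) m \<omega>))"
    using w_indep_slice[OF m] by (subst indep_vars_iff_distr_eq_PiM'[symmetric]) (use ne m in \<open>auto simp: indices_def intro: w_measurable\<close>)
  also have "\<dots> = PiM indices (\<lambda>_. normal_law 0 (\<sigma>w\<^sup>2))"
    using m by (intro PiM_cong refl) (auto simp: indices_def w_law)
  finally show ?thesis by (simp add: weights_def[abs_def] case_prod_beta')
qed

text \<open>The Cramer-Wold reduction: a linear combination of values of \<open>ybar\<close> at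
  several points is a normalized sum of i.i.d. real variables \<open>Y n\<close>, whose variance
  \<open>V\<close> is the quadratic form of the kernel.\<close>

lemma
  fixes P :: "(real^'d)^'p" and t :: "'p \<Rightarrow> real"
  defines "V \<equiv> \<Sum>i\<in>UNIV. \<Sum>j\<in>UNIV. t i * t j * kernel J \<phi> \<sigma>w (P $ i) (P $ j)"
  shows ybar_square_integrable: "integrable \<Omega> (\<lambda>\<omega>. (\<Sum>i\<in>UNIV. t i * ybar J \<phi> w M (P $ i) \<omega>)\<^sup>2)"
    and ybar_second_moment: "M > 0 \<Longrightarrow> expectation (\<lambda>\<omega>. (\<Sum>i\<in>UNIV. t i * ybar J \<phi> w M (P $ i) \<omega>)\<^sup>2) = V"
    and ybar_characteristic: "(\<lambda>M. \<integral>\<omega>. cis (\<Sum>i\<in>UNIV. t i * ybar J \<phi> w M (P $ i) \<omega>) \<partial>\<Omega>)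
      \<longlonglongrightarrow> complex_of_real (exp (- (V / 2)))"
proof -
  define H where "H v = (\<Sum>i\<in>UNIV. t i * feature (P $ i) v)" for v
  define Y where "Y n \<omega> = H (weights (Suc n) \<omega>)" for n \<omega>
  have H_meas: "H \<in> borel_measurable (PiM indices (\<lambda>_. borel))"
    unfolding H_def by (intro borel_measurable_sum borel_measurable_times borel_measurable_const measurable_feature)
  have sum_Y: "(\<Sum>i\<in>UNIV. t i * ybar J \<phi> w M (P $ i) \<omega>) = 1 / sqrt (real M) * (\<Sum>n<M. Y n \<omega>)" for M \<omega>
    unfolding ybar_eq_feature Y_def H_def
    by (subst sum.swap) (simp add: sum_distrib_left mult_ac)
  have ind: "indep_vars (\<lambda>_. borel) Y UNIV"
    unfolding Y_def[abs_def] by (rule indep_vars_compose2[OF weights_indep]) (rule H_meas)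
  have law: "distr \<Omega> borel (Y n) = distr (PiM indices (\<lambda>_. normal_law 0 (\<sigma>w\<^sup>2))) borel H" for n
    unfolding weights_distr[of "Suc n", simplified, symmetric]
    by (subst distr_distr[OF H_meas weights_measurable]) (simp_all add: Y_def[abs_def] comp_def)
  have mean: "expectation (Y n) = 0" for n
    unfolding Y_def[abs_def] H_def by (simp add: feature_integrable feature_mean)
  have eq: "(Y n \<omega>)\<^sup>2 = (\<Sum>i\<in>UNIV. \<Sum>j\<in>UNIV. t i * t j *
      (feature (P $ i) (weights (Suc n) \<omega>) * feature (P $ j) (weights (Suc n) \<omega>)))" for n \<omega>
    unfolding Y_def H_def power2_eq_square sum_product by (simp add: mult_ac)
  have sq: "integrable \<Omega> (\<lambda>\<omega>. (Y n \<omega>)\<^sup>2)" for n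
    unfolding eq by (simp add: feature_prod_integrable)
  have var: "expectation (\<lambda>\<omega>. (Y n \<omega>)\<^sup>2) = V" for n
    unfolding eq V_def by (simp add: feature_prod_integrable feature_prod_mean)
  show "integrable \<Omega> (\<lambda>\<omega>. (\<Sum>i\<in>UNIV. t i * ybar J \<phi> w M (P $ i) \<omega>)\<^sup>2)"
    "M > 0 \<Longrightarrow> expectation (\<lambda>\<omega>. (\<Sum>i\<in>UNIV. t i * ybar J \<phi> w M (P $ i) \<omega>)\<^sup>2) = V"
    unfolding sum_Y by (rule iid_normalized_sum_second_moment[OF ind sq mean var], assumption?)+
  show "(\<lambda>M. \<integral>\<omega>. cis (\<Sum>i\<in>UNIV. t i * ybar J \<phi> w M (P $ i) \<omega>) \<partial>\<Omega>) \<longlonglongrightarrow> complex_of_real (exp (- (V / 2)))"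
    unfolding sum_Y by (rule iid_normalized_sum_characteristic[OF ind law sq mean var])
qed

lemma ybar_measurable: "ybar J \<phi> w M x \<in> borel_measurable \<Omega>"
proof -
  have "(\<lambda>\<omega>. feature x (weights (Suc m) \<omega>)) \<in> borel_measurable \<Omega>" for m
    by (rule measurable_compose[OF weights_measurable measurable_feature]) simp
  then have "(\<lambda>\<omega>. 1 / sqrt (real M) * (\<Sum>m<M. feature x (weights (Suc m) \<omega>))) \<in> borel_measurable \<Omega>"
    by (intro borel_measurable_times borel_measurable_sum borel_measurable_const)
  then show ?thesis unfolding ybar_eq_feature[symmetric] .
qed

end


section \<open>Convergence of the posteriors\<close>

lemma eval_at_join_points:
  "(\<chi> a. eval_at h (join_points Xs X) \<omega> $ Inl a) = eval_at h Xs \<omega>"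
  "(\<chi> b. eval_at h (join_points Xs X) \<omega> $ Inr b) = eval_at h X \<omega>"
  by (simp_all add: eval_at_def)

text \<open>Bayes' rule is a quotient of two expectations of bounded continuous functions of the joint vector
  of test and training values, and the denominator has a positive limit.\<close>

lemma weakly_converges_posterior:
  fixes X :: "'x^'n" and Xs :: "'x^'s" and h :: "nat \<Rightarrow> 'x \<Rightarrow> 'a \<Rightarrow> real" and g :: "'x \<Rightarrow> 'b \<Rightarrow> real"
  assumes M: "prob_space M" and h: "\<And>n x. h n x \<in> borel_measurable M"
    and N: "prob_space N" and g: "\<And>x. g x \<in> borel_measurable N"
    and conv: "weakly_converges (\<lambda>n. distr M borel (eval_at (h n) (join_points Xs X)))
      (distr N borel (eval_at g (join_points Xs X)))"
  shows "weakly_converges (\<lambda>n. posterior M (h n) X y \<sigma>n Xs) (posterior N g X y \<sigma>n Xs)"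
  unfolding weakly_converges_def
proof (intro conjI allI impI)
  fix f :: "real^'s \<Rightarrow> real" assume f: "continuous_on UNIV f" and bdd: "bounded (range f)"
  define L :: "real^('s + 'n) \<Rightarrow> real" where "L z = likelihood \<sigma>n y (\<chi> b. z $ Inr b)" for z
  define F :: "real^('s + 'n) \<Rightarrow> real" where "F z = L z * f (\<chi> a. z $ Inl a)" for z
  have L_cont: "continuous_on UNIV L" unfolding L_def likelihood_def by (intro continuous_intros)
  have F_cont: "continuous_on UNIV F"
    unfolding F_def by (intro continuous_on_mult L_cont continuous_on_compose2[OF f] continuous_intros) auto
  obtain B where B: "\<And>z. \<bar>f z\<bar> \<le> B" using bdd unfolding bounded_iff by auto
  have L_bdd: "bounded (range L)"
    unfolding bounded_iff by (intro exI[of _ 1]) (auto simp: L_def likelihood_pos less_imp_le likelihood_le_1)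
  have F_bdd: "bounded (range F)"
    unfolding bounded_iff
  proof (intro exI[of _ "1 * B"] ballI)
    fix u assume "u \<in> range F"
    then obtain z where u: "u = F z" by blast
    show "norm u \<le> 1 * B"
      unfolding u F_def L_def real_norm_def abs_mult
      by (intro mult_mono B) (auto simp: likelihood_pos less_imp_le likelihood_le_1)
  qed
  \<comment> \<open>Stated for an arbitrary random function so that it applies both to the
    approximating sequence and to the limit, which live on different probability spaces.\<close>
  have quot: "(\<integral>z. f z \<partial>posterior K q X y \<sigma>n Xs) =
      (\<integral>z. F z \<partial>distr K borel (eval_at q (join_points Xs X))) / (\<integral>z. L z \<partial>distr K borel (eval_at q (join_points Xs X)))"
    and pos: "(\<integral>z. L z \<partial>distr K borel (eval_at q (join_points Xs X))) > 0"
    if K: "prob_space K" "\<And>x. q x \<in> borel_measurable K" for K :: "'c measure" and q :: "'x \<Rightarrow> 'c \<Rightarrow> real"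
  proof -
    note [measurable] = borel_measurable_continuous_onI[OF L_cont] borel_measurable_continuous_onI[OF F_cont]
      measurable_eval_at[of q K, OF K(2)]
    have L: "(\<integral>z. L z \<partial>distr K borel (eval_at q (join_points Xs X))) = (\<integral>\<omega>. likelihood \<sigma>n y (eval_at q X \<omega>) \<partial>K)"
      by (subst integral_distr) (auto simp: L_def eval_at_join_points)
    have "(\<integral>z. F z \<partial>distr K borel (eval_at q (join_points Xs X))) =
        (\<integral>\<omega>. likelihood \<sigma>n y (eval_at q X \<omega>) * f (eval_at q Xs \<omega>) \<partial>K)"
      by (subst integral_distr) (auto simp: F_def L_def eval_at_join_points)
    then show "(\<integral>z. f z \<partial>posterior K q X y \<sigma>n Xs) =
      (\<integral>z. F z \<partial>distr K borel (eval_at q (join_points Xs X))) / (\<integral>z. L z \<partial>distr K borel (eval_at q (join_points Xs X)))"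
      using integral_posterior[OF K borel_measurable_continuous_onI[OF f], where X = X and y = y and \<sigma>n = \<sigma>n and Xs = Xs] L
      by (simp add: divide_inverse mult.commute)
    show "(\<integral>z. L z \<partial>distr K borel (eval_at q (join_points Xs X))) > 0"
      unfolding L by (rule integral_likelihood_pos[OF K])
  qed
  have lim: "(\<lambda>n. \<integral>z. G z \<partial>distr M borel (eval_at (h n) (join_points Xs X)))
      \<longlonglongrightarrow> (\<integral>z. G z \<partial>distr N borel (eval_at g (join_points Xs X)))"
    if "continuous_on UNIV G" "bounded (range G)" for G :: "real^('s + 'n) \<Rightarrow> real"
    using conv that unfolding weakly_converges_def by blast
  show "(\<lambda>n. \<integral>z. f z \<partial>posterior M (h n) X y \<sigma>n Xs) \<longlonglongrightarrow> (\<integral>z. f z \<partial>posterior N g X y \<sigma>n Xs)"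
    unfolding quot[of M "h n" for n, OF M h] quot[of N g, OF N g]
    using pos[of N g, OF N g] by (intro tendsto_divide lim F_cont F_bdd L_cont L_bdd) simp
qed (rule prob_space_posterior[OF M h] prob_space_posterior[OF N g] sets_posterior[OF M h] sets_posterior[OF N g])+

text \<open>The characteristic functions agree in the limit because both sides involve the same
  kernel form. The uniform moment bound is the trace of the kernel matrix at \<open>P\<close>,
  attained for each \<open>M > 0\<close> and by the limit itself.\<close>

lemma (in iid_normal_weights) weakly_converges_ybar:
  fixes P :: "(real^'d)^'p" and g :: "real^'d \<Rightarrow> 'b \<Rightarrow> real"
  assumes gp: "centered_gaussian_process N g (kernel J \<phi> \<sigma>w)"
  shows "weakly_converges (\<lambda>M. distr \<Omega> borel (eval_at (ybar J \<phi> w M) P)) (distr N borel (eval_at g P))"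
proof -
  define S where "S i j = kernel J \<phi> \<sigma>w (P $ i) (P $ j)" for i j
  have mn: "multivariate_normal N UNIV (\<lambda>i. g (P $ i)) (\<lambda>_. 0) S"
    unfolding S_def[abs_def] by (rule centered_gaussian_process_finite[OF gp])
  have prob: "prob_space N" using mn by (simp add: multivariate_normal_def)
  interpret N: prob_space N by (rule prob)
  have g: "g x \<in> borel_measurable N" for x
    using centered_gaussian_process_finite[OF gp, of "\<chi> i :: unit. x"] by (simp add: multivariate_normal_def)
  note e_ybar = measurable_eval_at[of "ybar J \<phi> w M" \<Omega> for M, OF ybar_measurable]
  note e_g = measurable_eval_at[of g N, OF g]
  have cis_meas: "(\<lambda>x::real^'p. cis (t \<bullet> x)) \<in> borel_measurable borel" for t
    unfolding cis_conv_exp by (intro borel_measurable_continuous_onI continuous_intros)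
  have norm_meas: "(\<lambda>x::real^'p. (norm x)\<^sup>2) \<in> borel_measurable borel" by simp
  have inner: "t \<bullet> eval_at q P \<omega> = (\<Sum>i\<in>UNIV. t $ i * q (P $ i) \<omega>)" for t q and \<omega> :: 'c
    by (simp add: inner_vec_def eval_at_def)
  have norm2: "(norm (eval_at q P \<omega>))\<^sup>2 = (\<Sum>i\<in>UNIV. (q (P $ i) \<omega>)\<^sup>2)" for q and \<omega> :: 'c
    unfolding power2_norm_eq_inner by (simp add: inner_vec_def eval_at_def power2_eq_square)
  have S_diag: "(\<integral>\<omega>. (g (P $ i) \<omega>)\<^sup>2 \<partial>N) = S i i" for i
    using multivariate_normal_moments(5)[OF mn, of i i] by (simp add: power2_eq_square)
  have unit: "(\<Sum>j\<in>UNIV. (if j = i then 1 else 0) * f j) = f i" for i :: 'p and f :: "'p \<Rightarrow> real"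
    by (simp add: mult_delta_left)
  have y_int: "integrable \<Omega> (\<lambda>\<omega>. (ybar J \<phi> w M (P $ i) \<omega>)\<^sup>2)" for M i
    using ybar_square_integrable[of "\<lambda>j. if j = i then 1 else 0" M P] unfolding unit .
  \<comment> \<open>Equality holds for \<open>M > 0\<close>; the zero function at
    \<open>M = 0\<close> leaves only an inequality, which the moment bound for every index of the
    sequence can accommodate.\<close>
  have y_le: "expectation (\<lambda>\<omega>. (ybar J \<phi> w M (P $ i) \<omega>)\<^sup>2) \<le> S i i" for M i
  proof (cases "M = 0")
    case True
    have "S i i \<ge> 0" unfolding S_diag[symmetric] by simp
    then show ?thesis using True by (simp add: ybar_def)
  next
    case False
    then show ?thesis
      using ybar_second_moment[of M "\<lambda>j. if j = i then 1 else 0" P] unfolding unit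
      by (simp add: mult_delta_left mult_delta_right S_def)
  qed
  show ?thesis
  proof (rule weakly_converges_characteristic)
    show "prob_space (distr \<Omega> borel (eval_at (ybar J \<phi> w M) P))" for M by (rule prob_space_distr[OF e_ybar])
    show "prob_space (distr N borel (eval_at g P))" by (rule N.prob_space_distr[OF e_g])
    fix t :: "real^'p"
    have "(\<lambda>M. \<integral>\<omega>. cis (\<Sum>i\<in>UNIV. t $ i * ybar J \<phi> w M (P $ i) \<omega>) \<partial>\<Omega>)
        \<longlonglongrightarrow> (\<integral>\<omega>. cis (\<Sum>i\<in>UNIV. t $ i * g (P $ i) \<omega>) \<partial>N)"
      using ybar_characteristic[of "\<lambda>i. t $ i" P] multivariate_normal_char[OF mn, of "\<lambda>i. t $ i"]
      by (simp add: S_def)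
    then show "(\<lambda>M. \<integral>x. cis (t \<bullet> x) \<partial>distr \<Omega> borel (eval_at (ybar J \<phi> w M) P))
        \<longlonglongrightarrow> (\<integral>x. cis (t \<bullet> x) \<partial>distr N borel (eval_at g P))"
      unfolding integral_distr[OF e_ybar cis_meas] integral_distr[OF e_g cis_meas] inner .
  next
    fix M
    show "integrable (distr \<Omega> borel (eval_at (ybar J \<phi> w M) P)) (\<lambda>x. (norm x)\<^sup>2)"
      unfolding integrable_distr_eq[OF e_ybar norm_meas] norm2 by (intro Bochner_Integration.integrable_sum y_int)
    show "(\<integral>x. (norm x)\<^sup>2 \<partial>distr \<Omega> borel (eval_at (ybar J \<phi> w M) P)) \<le> (\<Sum>i\<in>UNIV. S i i)"
      unfolding integral_distr[OF e_ybar norm_meas] norm2 using y_int y_le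
      by (subst Bochner_Integration.integral_sum) (auto intro: sum_mono)
  next
    have g_int: "integrable N (\<lambda>\<omega>. (g (P $ i) \<omega>)\<^sup>2)" for i by (rule multivariate_normal_moments(2)[OF mn])
    show "integrable (distr N borel (eval_at g P)) (\<lambda>x. (norm x)\<^sup>2)"
      unfolding integrable_distr_eq[OF e_g norm_meas] norm2 by (intro Bochner_Integration.integrable_sum g_int)
    show "(\<integral>x. (norm x)\<^sup>2 \<partial>distr N borel (eval_at g P)) \<le> (\<Sum>i\<in>UNIV. S i i)"
      unfolding integral_distr[OF e_g norm_meas] norm2 using g_int
      by (subst Bochner_Integration.integral_sum) (auto simp: S_diag)
  qed simp_all
qed

theorem theorem3p3:
  fixes J :: "'d::finite \<Rightarrow> nat"
    and c :: "'d \<Rightarrow> nat \<Rightarrow> real" and l :: "'d \<Rightarrow> real"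
    and \<phi> :: "'d \<Rightarrow> nat \<Rightarrow> real \<Rightarrow> real"
    and \<sigma>w \<sigma>n :: real
    and \<Omega> :: "'a measure" and w :: "'d \<Rightarrow> nat \<Rightarrow> nat \<Rightarrow> 'a \<Rightarrow> real"
    and X :: "(real^'d)^'n" and Xs :: "(real^'d)^'s" and y :: "real^'n"
    and k :: "real^'d \<Rightarrow> real^'d \<Rightarrow> real"
    and N :: "'b measure" and g :: "real^'d \<Rightarrow> 'b \<Rightarrow> real"
  assumes J: "\<And>d. J d \<ge> 1"
    and l: "\<And>d. l d > 0"
    and \<phi>: "\<And>d j. \<phi> d j = rbf (c d j) (l d)"
    and \<sigma>w: "\<sigma>w > 0" and \<sigma>n: "\<sigma>n > 0"
    and \<Omega>: "prob_space \<Omega>"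
    and w_normal: "\<And>d j m. j \<in> {1..J d} \<Longrightarrow> m \<ge> 1 \<Longrightarrow>
          distributed \<Omega> lborel (w d j m) (\<lambda>t. ennreal (normal_density 0 \<sigma>w t))"
    and w_indep: "prob_space.indep_vars \<Omega> (\<lambda>_. borel) (\<lambda>(d, j, m). w d j m)
          {(d, j, m). j \<in> {1..J d} \<and> m \<ge> 1}"
    and k: "k = kernel J \<phi> \<sigma>w"
    and g: "centered_gaussian_process N g k"
  shows "weakly_converges (\<lambda>M. posterior \<Omega> (ybar J \<phi> w M) X y \<sigma>n Xs) (posterior N g X y \<sigma>n Xs) \<and>
    multivariate_normal_law (posterior N g X y \<sigma>n Xs)
      (kernel_matrix k Xs X ** matrix_inv (kernel_matrix k X X + \<sigma>n\<^sup>2 *\<^sub>R mat 1) *v y)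
      (kernel_matrix k Xs Xs
        - kernel_matrix k Xs X ** matrix_inv (kernel_matrix k X X + \<sigma>n\<^sup>2 *\<^sub>R mat 1) ** kernel_matrix k X Xs)"
proof
  interpret iid_normal_weights \<Omega> J w \<sigma>w \<phi>
    by (intro iid_normal_weights.intro iid_normal_weights_axioms.intro \<Omega> J \<sigma>w w_normal w_indep)
  note gp = g[unfolded k]
  have "prob_space N" "\<And>x. g x \<in> borel_measurable N"
    using centered_gaussian_process_finite[OF g, of "\<chi> i :: unit. x" for x] by (simp_all add: multivariate_normal_def)
  then show "weakly_converges (\<lambda>M. posterior \<Omega> (ybar J \<phi> w M) X y \<sigma>n Xs) (posterior N g X y \<sigma>n Xs)"
    by (intro weakly_converges_posterior weakly_converges_ybar gp \<Omega> ybar_measurable)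
qed (rule posterior_gaussian_process[OF g \<sigma>n])

end
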